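(* Let $n\ge 3$ and $l\ge 2$ be integers. (i) If $l\ge 4$ and $l$ is even, then there is a constant $C_l>0$ depending only on $l$ such that $\mathrm{ex}(CT_n,C_{2l})\le C_l\, n^{-1+\frac{2}{l}}\, e(CT_n)$ for all $n\ge 3$. (ii) If $l\ge 4$ and $l$ is odd, then there is a constant $C_l>0$ depending only on $l$ such that for all $n\ge 3$: if $l=7$ then $\mathrm{ex}(CT_n,C_{2l})\le C_l\, n^{-\frac{1}{l}}\, e(CT_n)$, and otherwise $\mathrm{ex}(CT_n,C_{2l})\le C_l\, n^{-\frac18+\frac{1}{4(l-3)}}\, e(CT_n)$. (iii) If $l=3$, then $\mathrm{ex}(CT_n,C_{6})\le (\sqrt2-1+o(1))\, e(CT_n)$ as $n\to\infty$. (iv) If $l=2$, then $\mathrm{ex}(CT_n,C_{4})\le \frac34\, e(CT_n)$.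
   Context: $\mathrm{S}_n$ is the symmetric group on $\{1,\dots,n\}$. The complete transposition graph $CT_n$ is the Cayley graph on $\mathrm{S}_n$ whose connection set is the set of all transpositions: its vertex set is $\mathrm{S}_n$ and $\{x,y\}$ is an edge iff $yx^{-1}$ is a transposition. It is $\binom n2$-regular and bipartite with $n!$ vertices, so $e(CT_n)=\frac{n!}{2}\binom n2$. $C_m$ denotes the cycle of length $m$. For graphs $G$ and $H$, $\mathrm{ex}(G,H)$ is the maximum number of edges of a spanning subgraph of $G$ that contains no subgraph isomorphic to $H$. *)

theory Defs
  imports Complex_Main "HOL-Combinatorics.Combinatorics"
begin

definition CT_vertices :: "nat \<Rightarrow> (nat \<Rightarrow> nat) set" where
  "CT_vertices n = {p. p permutes {1..n}}"

definition CT_edges :: "nat \<Rightarrow> (nat \<Rightarrow> nat) set set" where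
  "CT_edges n = {{x, Transposition.transpose a b \<circ> x} | x a b.
      x permutes {1..n} \<and> a \<in> {1..n} \<and> b \<in> {1..n} \<and> a \<noteq> b}"

definition e_CT :: "nat \<Rightarrow> nat" where
  "e_CT n = card (CT_edges n)"

text \<open>An edge set F (of a simple graph) contains a cycle of length m (m \<ge> 3).\<close>
definition has_cycle :: "'a set set \<Rightarrow> nat \<Rightarrow> bool" where
  "has_cycle F m \<longleftrightarrow> (\<exists>vs. length vs = m \<and> distinct vs \<and>
      (\<forall>i<m. {vs ! i, vs ! ((i + 1) mod m)} \<in> F))"

definition ex_CT_cycle :: "nat \<Rightarrow> nat \<Rightarrow> nat" where
  "ex_CT_cycle n m = Max {card F | F. F \<subseteq> CT_edges n \<and> \<not> has_cycle F m}"

end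

theory Submission
  imports Defs
begin

text \<open>Fix a subgraph \<open>F\<close> and a vertex \<open>v\<close>. Join two commuting transpositions \<open>i \<noteq> t\<close> in the
  local graph at \<open>v\<close> if \<open>F\<close> contains both edges from \<open>i \<circ> t \<circ> v\<close> to \<open>i \<circ> v\<close> and \<open>t \<circ> v\<close>. Counting
  paths of length two by their middle vertex shows that the local graphs have on average about
  \<open>d\<^sup>2/2\<close> edges, where \<open>d\<close> is the average degree of \<open>F\<close>, and an \<open>l\<close>-cycle in a local graph lifts to
  a \<open>2l\<close>-cycle of \<open>F\<close>. For even \<open>l\<close> the even cycle theorem of Bondy and Simonovits finishes the proof.

  For odd \<open>l \<ge> 7\<close>, lift a 4-cycle and an \<open>(l - 3)\<close>-cycle of two different local graphs so that they
  share exactly one edge; their symmetric difference is a \<open>2l\<close>-cycle. If this never works, then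
  almost all \<open>(l - 3)\<close>-cycles of the local graphs are forced to follow a fixed matching of the edges
  at each vertex, and deleting half of the edges destroys them all, against the even cycle theorem.
  This gives the exponent \<open>-1/2\<close>, which is better than required; for \<open>l = 5\<close> the required exponent
  is \<open>0\<close>.

  Without 6-cycles the local graph at \<open>v\<close> is triangle-free, and each of its vertices has at most one
  neighbour among the directions of the \<open>F\<close>-edges at \<open>v\<close>, so Mantel's theorem applies to the
  remaining directions. For 4-cycles it suffices to average over the 4-cycles generated by the three
  transpositions of a triple.\<close>

section \<open>Finite relations and cycles\<close>

text \<open>A local graph has about n^2/2 vertices, so forbidding 2k-cycles in it bounds its edges
  by O(n^(2+2/k)). Comparison with d^2 gives d = O(n^(1+1/k)), and division by the degree of the
  host graph, of order n^2, yields the exponent -1+1/k: this is -1+2/l for l = 2k, and -1/2 for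
  local 4-cycles. Non-commuting pairs of directions cost only O(n d) per vertex, which is harmless
  once d exceeds the order of n.

  Odd l is obstructed by bipartite local graphs, which may be dense without containing any l-cycle.
  Hence two even cycles, based at neighbours of a common vertex, are combined: lifts of lengths 8
  and 2(l-3) sharing one edge leave 8+2(l-3)-2 = 2l. For l = 5 the second cycle would degenerate to
  length 2.

  The constant sqrt 2 - 1 is the positive root of a^2 = (1-a)^2/2, where a is the density of
  \<open>F\<close>: with N directions in all, a^2 N^2 ordered local edges must fit into Mantel's
  bound on (1-a)N vertices. The constant 3/4 says that of the four edges of each 4-cycle at least
  one is missing.\<close>

lemma dense_imp_min_degree_bipartite:
  fixes B :: "('a \<times> 'b) set"
  assumes "finite B" "B \<noteq> {}" "card B \<ge> c * (card (Domain B) + card (Range B))"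
  shows "\<exists>B'\<subseteq>B. B' \<noteq> {} \<and> card B' \<ge> c * (card (Domain B') + card (Range B')) \<and>
    (\<forall>x\<in>Domain B'. card (B' `` {x}) \<ge> c) \<and> (\<forall>y\<in>Range B'. card (B'\<inverse> `` {y}) \<ge> c)"
  using assms
proof (induction B rule: finite_psubset_induct)
  case (psubset B)
  have fin: "finite (Domain B)" "finite (Range B)"
    using psubset.hyps by (auto simp: finite_Domain finite_Range)
  \<comment> \<open>Deleting fewer than \<open>c\<close> pairs together with at least one endpoint
    keeps the density bound, even strictly, so the smaller relation is nonempty and the induction
    hypothesis applies.\<close>
  have smaller: ?case
    if "B0 \<subset> B" "card B < card B0 + c"
      "card (Domain B0) + card (Range B0) < card (Domain B) + card (Range B)" for B0
  proof -
    have "c * (card (Domain B0) + card (Range B0)) + c \<le> c * (card (Domain B) + card (Range B))"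
      using mult_le_mono2[of "Suc (card (Domain B0) + card (Range B0))"
          "card (Domain B) + card (Range B)" c] that(3) by simp
    then have "c * (card (Domain B0) + card (Range B0)) < card B0"
      using that(2) psubset.prems(2) by linarith
    moreover from this have "B0 \<noteq> {}" by auto
    ultimately show ?thesis
      using psubset.IH[OF that(1)] that(1) by (meson less_imp_le order.trans psubset_imp_subset)
  qed
  show ?case
  proof (cases "(\<forall>x\<in>Domain B. card (B `` {x}) \<ge> c) \<and> (\<forall>y\<in>Range B. card (B\<inverse> `` {y}) \<ge> c)")
    case True
    then show ?thesis using psubset.prems by blast
  next
    case False
    then consider x where "x \<in> Domain B" "card (B `` {x}) < c"
      | y where "y \<in> Range B" "card (B\<inverse> `` {y}) < c"
      by (meson not_le)
    then show ?thesis
    proof cases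
      case 1
      let ?D = "Pair x ` (B `` {x})"
      have D: "?D = B \<inter> {x} \<times> UNIV" by auto
      have "card ?D = card (B `` {x})" by (rule card_image) (simp add: inj_on_def)
      moreover have "card (B - ?D) + card ?D = card B"
        using card_Diff_subset[of ?D B] card_mono[of B ?D] psubset.hyps D
        by (simp add: finite_subset)
      moreover have "B - ?D \<subset> B" using 1 D by auto
      moreover have "card (Domain (B - ?D)) < card (Domain B)"
        using 1 fin by (intro psubset_card_mono) (auto simp: D)
      moreover have "card (Range (B - ?D)) \<le> card (Range B)"
        using fin by (intro card_mono) auto
      ultimately show ?thesis using 1 by (intro smaller[of "B - ?D"]) (assumption | linarith)+
    next
      case 2
      let ?D = "(\<lambda>x. (x, y)) ` (B\<inverse> `` {y})"
      have D: "?D = B \<inter> UNIV \<times> {y}" by auto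
      have "card ?D = card (B\<inverse> `` {y})" by (rule card_image) (simp add: inj_on_def)
      moreover have "card (B - ?D) + card ?D = card B"
        using card_Diff_subset[of ?D B] card_mono[of B ?D] psubset.hyps D
        by (simp add: finite_subset)
      moreover have "B - ?D \<subset> B" using 2 D by auto
      moreover have "card (Range (B - ?D)) < card (Range B)"
        using 2 fin by (intro psubset_card_mono) (auto simp: D)
      moreover have "card (Domain (B - ?D)) \<le> card (Domain B)"
        using fin by (intro card_mono) auto
      ultimately show ?thesis using 2 by (intro smaller[of "B - ?D"]) (assumption | linarith)+
    qed
  qed
qed

definition cyc :: "('a \<times> 'a) set \<Rightarrow> 'a list \<Rightarrow> bool" where
  "cyc R xs \<longleftrightarrow> distinct xs \<and> successively (\<lambda>x y. (x, y) \<in> R) xs \<and> xs \<noteq> [] \<and> (last xs, hd xs) \<in> R"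

lemma cyc_mono: "R \<subseteq> S \<Longrightarrow> cyc R xs \<Longrightarrow> cyc S xs"
  unfolding cyc_def by (auto elim!: successively_mono)

lemma greedy_path:
  fixes B :: "('a \<times> 'a) set"
  assumes "finite B"
    and deg1: "\<And>x. x \<in> Domain B \<Longrightarrow> card (B `` {x}) \<ge> 2 * m"
    and deg2: "\<And>y. y \<in> Range B \<Longrightarrow> card (B\<inverse> `` {y}) \<ge> 2 * m"
    and y: "y \<in> Range B" and k: "1 \<le> k" "k \<le> m"
  shows "\<exists>ps. distinct ps \<and> length ps = 2 * k \<and> last ps = y \<and> hd ps \<in> Domain B \<and>
    successively (\<lambda>u v. (u, v) \<in> B \<or> (v, u) \<in> B) ps \<and> set ps \<subseteq> Field B"
  using k
proof (induction k rule: nat_induct_at_least)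
  case base
  have "\<not> B\<inverse> `` {y} \<subseteq> {y}"
    using deg2[OF y] base card_mono[of "{y}" "B\<inverse> `` {y}"] by auto
  then obtain x where "(x, y) \<in> B" "x \<noteq> y" by auto
  then show ?case by (intro exI[of _ "[x, y]"]) (auto simp: Field_def)
next
  case (Suc k)
  then obtain ps where ps: "distinct ps" "length ps = 2 * k" "last ps = y" "hd ps \<in> Domain B"
    "successively (\<lambda>u v. (u, v) \<in> B \<or> (v, u) \<in> B) ps" "set ps \<subseteq> Field B"
    by auto
  have ne: "ps \<noteq> []" using ps(2) Suc.hyps by auto
  have cps: "card (set ps) = 2 * k" using ps by (simp add: distinct_card)
  have "\<not> B `` {hd ps} \<subseteq> set ps"
    using deg1[OF ps(4)] card_mono[of "set ps" "B `` {hd ps}"] cps Suc.prems by auto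
  then obtain z where z: "(hd ps, z) \<in> B" "z \<notin> set ps" by auto
  then have "z \<in> Range B" by auto
  have "\<not> B\<inverse> `` {z} \<subseteq> set (z # ps)"
    using deg2[OF \<open>z \<in> Range B\<close>] card_mono[of "set (z # ps)" "B\<inverse> `` {z}"] cps z Suc.prems by auto
  then obtain x where x: "(x, z) \<in> B" "x \<notin> set (z # ps)" by auto
  show ?case
    using ps x z ne
    by (intro exI[of _ "x # z # ps"]) (auto simp: successively_Cons Field_def)
qed

text \<open>The proper ancestors of the two ends of \<open>qs\<close> lie in layers of index below
  \<open>i\<close>, which \<open>qs\<close> avoids, and ancestors at different heights lie in
  disjoint layers. The two climbs stay apart for \<open>r\<close> steps and meet after
  \<open>Suc r\<close>, so they add \<open>r + 1\<close> vertices after the last end and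
  \<open>r\<close> before the first.\<close>

lemma tree_cycle:
  assumes sym: "sym R"
    and disj: "\<And>a b. a \<noteq> b \<Longrightarrow> L a \<inter> L b = {}"
    and par: "\<And>j v. v \<in> L (Suc j) \<Longrightarrow> par v \<in> L j \<and> (v, par v) \<in> R"
    and qs: "distinct qs" "successively (\<lambda>u v. (u, v) \<in> R) qs" "qs \<noteq> []"
    and levels: "\<And>j. j < i \<Longrightarrow> set qs \<inter> L j = {}"
    and ends: "hd qs \<in> L i" "last qs \<in> L i"
    and r: "Suc r \<le> i"
    and meet: "(par ^^ Suc r) (hd qs) = (par ^^ Suc r) (last qs)"
      "(par ^^ r) (hd qs) \<noteq> (par ^^ r) (last qs)"
  shows "\<exists>xs. cyc R xs \<and> length xs = length qs + 2 * r + 1"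
proof -
  \<comment> \<open>The ancestors at heights 1 to \<open>m\<close>; \<open>x\<close> itself is left
    out since it already belongs to \<open>qs\<close>.\<close>
  define up where "up = (\<lambda>x m. map (\<lambda>j. (par ^^ j) x) [1..<Suc m])"
  have lev: "(par ^^ j) x \<in> L (i - j)" if "x \<in> L i" "j \<le> i" for x j
    using that(2)
  proof (induction j)
    case (Suc j)
    then have "(par ^^ j) x \<in> L (Suc (i - Suc j))" using Suc_diff_Suc by fastforce
    then show ?case using par by simp
  qed (use that in simp)
  have edge: "((par ^^ j) x, (par ^^ Suc j) x) \<in> R" if "x \<in> L i" "j < i" for x j
  proof -
    have "(par ^^ j) x \<in> L (Suc (i - Suc j))" using lev[of x j] that by (simp add: Suc_diff_Suc)
    then show ?thesis using par by simp
  qed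
  have up_set: "set (up x m) = (\<lambda>j. (par ^^ j) x) ` {1..m}" for x m
    by (auto simp: up_def)
  have inj: "a = b" if "(par ^^ a) x = (par ^^ b) x'" "x \<in> L i" "x' \<in> L i" "a \<le> i" "b \<le> i" for a b x x'
    using lev[of x a] lev[of x' b] that disj[of "i - a" "i - b"] by (metis IntI diff_diff_cancel emptyE)
  have up_dist: "distinct (up x m)" if "x \<in> L i" "m \<le> i" for x m
    using that inj by (auto simp: up_def distinct_map inj_on_def)
  have up_succ: "successively (\<lambda>u v. (u, v) \<in> R) (up x m)" if "x \<in> L i" "m \<le> i" for x m
    using that edge[OF that(1), of "Suc _"] by (auto simp: up_def successively_conv_nth simp del: upt_Suc)
  have far: "(par ^^ j) (hd qs) \<noteq> (par ^^ j) (last qs)" if "j \<le> r" for j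
  proof
    assume "(par ^^ j) (hd qs) = (par ^^ j) (last qs)"
    then have "(par ^^ (r - j)) ((par ^^ j) (hd qs)) = (par ^^ (r - j)) ((par ^^ j) (last qs))" by simp
    moreover have "(par ^^ (r - j)) ((par ^^ j) x) = (par ^^ r) x" for x
      using that by (metis comp_apply funpow_add le_add_diff_inverse2)
    ultimately show False using meet(2) by simp
  qed
  let ?a = "hd qs" and ?b = "last qs"
  let ?xs = "qs @ up ?b (Suc r) @ rev (up ?a r)"
  have disj1: "set qs \<inter> set (up x m) = {}" if "x \<in> L i" "m \<le> i" for x m
  proof -
    have "(par ^^ j) x \<notin> set qs" if "j \<in> {1..m}" for j
      using that lev[of x j] levels[of "i - j"] \<open>x \<in> L i\<close> \<open>m \<le> i\<close> by auto
    then show ?thesis by (auto simp: up_set)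
  qed
  have disj2: "set (up ?b (Suc r)) \<inter> set (up ?a r) = {}"
  proof -
    have "(par ^^ j) ?b \<noteq> (par ^^ j') ?a" if "j \<in> {1..Suc r}" "j' \<in> {1..r}" for j j'
      using inj[of j ?b j' ?a] far[of j] ends that r by fastforce
    then show ?thesis by (auto simp: up_set)
  qed
  have "distinct ?xs"
    using qs(1) disj1 disj2 up_dist ends r by (auto simp: Int_Un_distrib)
  have hd_up: "hd (up x (Suc m)) = par x" "last (up x (Suc m)) = (par ^^ Suc m) x" for x m
  proof -
    show "hd (up x (Suc m)) = par x"
      unfolding up_def by (subst upt_conv_Cons) simp_all
    show "last (up x (Suc m)) = (par ^^ Suc m) x" by (simp add: up_def)
  qed
  have "successively (\<lambda>u v. (u, v) \<in> R) ?xs"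
  proof -
    have "successively (\<lambda>u v. (u, v) \<in> R) (rev (up ?a r))"
      unfolding successively_rev
      by (rule successively_mono[OF up_succ[OF ends(1)]]) (use r sym in \<open>auto elim: symE\<close>)
    moreover have "up ?a r = [] \<or> (last (up ?b (Suc r)), hd (rev (up ?a r))) \<in> R"
    proof (cases r)
      case 0
      then show ?thesis by (simp add: up_def)
    next
      case (Suc r')
      have "hd (rev (up ?a r)) = (par ^^ r) ?a"
        using hd_up(2)[of ?a r'] Suc by (simp add: hd_rev del: funpow.simps)
      moreover have "last (up ?b (Suc r)) = (par ^^ Suc r) ?a"
        using hd_up(2)[of ?b r] meet(1) by simp
      ultimately show ?thesis
        using edge[OF ends(1), of r] r sym by (metis Suc_le_lessD symD)
    qed
    moreover have "(?b, hd (up ?b (Suc r))) \<in> R"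
      using edge[OF ends(2), of 0] r by (simp add: hd_up)
    moreover have "successively (\<lambda>u v. (u, v) \<in> R) (up ?b (Suc r))"
      using up_succ ends r by blast
    moreover have "up ?b (Suc r) \<noteq> []" by (simp add: up_def)
    ultimately show ?thesis using qs by (simp add: successively_append_iff)
  qed
  moreover have "(last ?xs, hd ?xs) \<in> R"
  proof -
    have "last ?xs = par ?a"
    proof (cases r)
      case 0
      then have "last ?xs = last (up ?b (Suc r))" "last (up ?b (Suc r)) = par ?b" "par ?a = par ?b"
        using hd_up(2)[of ?b r] meet(1) by (simp_all add: up_def)
      then show ?thesis by simp
    next
      case (Suc r')
      then have "up ?a r \<noteq> []" by (simp add: up_def)
      then show ?thesis using hd_up(1)[of ?a r'] Suc by (simp add: last_rev)
    qed
    moreover have "hd ?xs = ?a" using qs(3) by simp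
    moreover have "(?a, par ?a) \<in> R" using edge[OF ends(1), of 0] r by simp
    ultimately show ?thesis using sym by (metis symD)
  qed
  ultimately have "cyc R ?xs" using qs(3) \<open>distinct ?xs\<close> by (simp add: cyc_def)
  moreover have "length ?xs = length qs + 2 * r + 1" by (simp add: up_def)
  ultimately show ?thesis by blast
qed

lemma card_rel_eq_sum_Range:
  assumes "finite B"
  shows "card B = (\<Sum>y\<in>Range B. card (B\<inverse> `` {y}))"
proof -
  have "card B = card (B\<inverse>)" by simp
  also have "B\<inverse> = (SIGMA y:Range B. B\<inverse> `` {y})" by auto
  also have "card \<dots> = (\<Sum>y\<in>Range B. card (B\<inverse> `` {y}))"
    using assms by (intro card_SigmaI) (auto simp: finite_Range)
  finally show ?thesis .
qed

text \<open>The label of the first component is determined by the second, so parts with different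
  labels share neither first nor second components. The sizes of the parts, their domains and their
  ranges then add up, and failure of the density bound on every part would make it fail for
  \<open>B\<close>.\<close>

lemma dense_relation_split:
  fixes B :: "('a \<times> 'b) set" and f :: "'a \<Rightarrow> 'c"
  assumes "finite B" "B \<noteq> {}"
    and a: "\<And>x y. (x, y) \<in> B \<Longrightarrow> f x = a y"
    and dense: "card B \<ge> c * (card (Domain B) + card (Range B))"
  shows "\<exists>z. {(x, y) \<in> B. f x = z} \<noteq> {} \<and>
    card {(x, y) \<in> B. f x = z} \<ge>
      c * (card (Domain {(x, y) \<in> B. f x = z}) + card (Range {(x, y) \<in> B. f x = z}))"
proof (rule ccontr)
  define P where "P = (\<lambda>z. {(x, y) \<in> B. f x = z})"
  define Z where "Z = f ` Domain B"
  assume neg: "\<not> ?thesis"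
  have finZ: "finite Z" "Z \<noteq> {}" using assms by (auto simp: Z_def finite_Domain)
  have finP: "finite (P z)" for z using assms(1) by (auto simp: P_def intro: finite_subset)
  have finDR: "finite (Domain (P z))" "finite (Range (P z))" for z
    using finP by (auto simp: finite_Domain finite_Range)
  have neP: "P z \<noteq> {}" if "z \<in> Z" for z using that by (auto simp: P_def Z_def)
  have small: "card (P z) < c * (card (Domain (P z)) + card (Range (P z)))" if "z \<in> Z" for z
    using neg neP[OF that] unfolding P_def by (meson not_le)
  have "B = (\<Union>z\<in>Z. P z)" by (auto simp: P_def Z_def)
  moreover have "card (\<Union>z\<in>Z. P z) = (\<Sum>z\<in>Z. card (P z))"
    using finZ finP by (intro card_UN_disjoint) (auto simp: P_def)
  ultimately have "card B = (\<Sum>z\<in>Z. card (P z))" by metis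
  also have "\<dots> < (\<Sum>z\<in>Z. c * (card (Domain (P z)) + card (Range (P z))))"
    using small finZ by (intro sum_strict_mono) auto
  also have "\<dots> = c * ((\<Sum>z\<in>Z. card (Domain (P z))) + (\<Sum>z\<in>Z. card (Range (P z))))"
    by (simp only: sum_distrib_left sum.distrib distrib_left)
  also have "(\<Sum>z\<in>Z. card (Domain (P z))) = card (\<Union>z\<in>Z. Domain (P z))"
    using finZ finDR by (intro card_UN_disjoint[symmetric]) (auto simp: P_def)
  also have "\<dots> \<le> card (Domain B)"
    using assms(1) by (intro card_mono) (auto simp: P_def finite_Domain)
  also have "(\<Sum>z\<in>Z. card (Range (P z))) = card (\<Union>z\<in>Z. Range (P z))"
    using finZ finDR by (intro card_UN_disjoint[symmetric]) (auto simp: P_def a)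
  also have "\<dots> \<le> card (Range B)"
    using assms(1) by (intro card_mono) (auto simp: P_def finite_Range)
  finally show False using dense by simp
qed

text \<open>If a path of length \<open>2 * (k - r)\<close> has its ends in different subtrees below the common ancestor
  \<open>r\<close> levels up, the tree closes it to a \<open>2k\<close>-cycle. Otherwise each vertex of the outer layer sees
  at least half of its neighbours in one subtree, and one subtree keeps half of the density.\<close>

lemma dense_layer_imp_cycle:
  fixes R :: "('a \<times> 'a) set"
  assumes sym: "sym R"
    and disj: "\<And>a b. a \<noteq> b \<Longrightarrow> L a \<inter> L b = {}"
    and par: "\<And>j v. v \<in> L (Suc j) \<Longrightarrow> par v \<in> L j \<and> (v, par v) \<in> R"
    and ik: "i < k"
    and "r \<le> i" "finite B" "B \<noteq> {}" "B \<subseteq> R" "Domain B \<subseteq> L i"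
    and "\<And>j. j < i \<Longrightarrow> Range B \<inter> L j = {}"
    and "\<And>x x'. x \<in> Domain B \<Longrightarrow> x' \<in> Domain B \<Longrightarrow> (par ^^ r) x = (par ^^ r) x'"
    and "card B \<ge> 2 ^ r * (2 * k) * (card (Domain B) + card (Range B))"
  shows "\<exists>xs. cyc R xs \<and> length xs = 2 * k"
  using assms(5-)
proof (induction r arbitrary: B)
  case 0
  \<comment> \<open>For \<open>r = 0\<close> all vertices of \<open>Domain B\<close> coincide. A
    star has no more pairs than second components, against the density bound.\<close>
  obtain x y where "(x, y) \<in> B" using 0 by auto
  moreover have "x' = x" if "x' \<in> Domain B" for x'
    using 0(7)[OF that, of x] \<open>(x, y) \<in> B\<close> by auto
  ultimately have sub: "B \<subseteq> {x} \<times> Range B" and pos: "card (Domain B) \<ge> 1"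
    using 0 by (auto simp: Suc_le_eq card_gt_0_iff finite_Domain)
  have "card B \<le> card ({x} \<times> Range B)"
    using sub 0 by (intro card_mono) (auto simp: finite_Range)
  then have "2 * k * (1 + card (Range B)) \<le> card (Range B)"
    using 0(8) pos mult_le_mono2[of "1 + card (Range B)" "card (Domain B) + card (Range B)" "2 * k"]
    by (simp add: card_cartesian_product)
  moreover have "1 * (1 + card (Range B)) \<le> 2 * k * (1 + card (Range B))"
    using ik by (intro mult_le_mono1) simp
  ultimately show ?case by simp
next
  case (Suc r)
  define c where "c = 2 ^ r * (2 * k)"
  define f where "f = par ^^ r"
  \<comment> \<open>A path of \<open>2 * m\<close> vertices, one further vertex and the
    \<open>2 * r + 1\<close> ancestors supplied by \<open>tree_cycle\<close> make
    \<open>2 * k\<close>.\<close>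
  define m where "m = k - Suc r"
  have m: "1 \<le> m" "m + Suc r = k" using Suc.prems(1) ik by (auto simp: m_def)
  have "1 * (2 * k) \<le> c" unfolding c_def by (intro mult_le_mono1) simp
  then have mc: "4 * m \<le> 2 * c" "2 * m \<le> 2 * c" using m by simp_all
  have "2 * c * (card (Domain B) + card (Range B)) \<le> card B"
    using Suc.prems(8) by (simp add: c_def mult.assoc)
  note dense_imp_min_degree_bipartite[OF Suc.prems(2,3) this]
  then obtain B' where "B' \<subseteq> B \<and> B' \<noteq> {} \<and>
      card B' \<ge> 2 * c * (card (Domain B') + card (Range B')) \<and>
      (\<forall>x\<in>Domain B'. card (B' `` {x}) \<ge> 2 * c) \<and> (\<forall>y\<in>Range B'. card (B'\<inverse> `` {y}) \<ge> 2 * c)"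
    by (rule exE)
  then have B': "B' \<subseteq> B" "B' \<noteq> {}"
      "card B' \<ge> 2 * c * (card (Domain B') + card (Range B'))"
      "\<forall>x\<in>Domain B'. card (B' `` {x}) \<ge> 2 * c" "\<forall>y\<in>Range B'. card (B'\<inverse> `` {y}) \<ge> 2 * c"
    by blast+
  have finB': "finite B'" by (rule finite_subset[OF B'(1) Suc.prems(2)])
  have deg: "2 * m \<le> card (B' `` {x})" if "x \<in> Domain B'" for x
    using B'(4) that mc(2) by (meson order.trans)
  have deg': "2 * m \<le> card (B'\<inverse> `` {y})" if "y \<in> Range B'" for y
    using B'(5) that mc(2) by (meson order.trans)
  show ?case
  proof (cases "\<exists>xs. cyc R xs \<and> length xs = 2 * k")
    case False
    \<comment> \<open>The label \<open>f x\<close> names the subtree, one level below the common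
      ancestor, that contains \<open>x\<close>. A predecessor of \<open>y\<close> off the path whose
      label differs from that of \<open>hd ps\<close> would close a cycle of length
      \<open>2 * k\<close>. The path itself hides at most \<open>2 * m\<close> predecessors, at most
      half of them since \<open>4 * m \<le> 2 * c\<close>.\<close>
    have maj: "\<exists>a. 2 * card {x \<in> B'\<inverse> `` {y}. f x = a} \<ge> card (B'\<inverse> `` {y})" if y: "y \<in> Range B'" for y
    proof -
      have "\<exists>ps. distinct ps \<and> length ps = 2 * m \<and> last ps = y \<and> hd ps \<in> Domain B' \<and>
        successively (\<lambda>u v. (u, v) \<in> B' \<or> (v, u) \<in> B') ps \<and> set ps \<subseteq> Field B'"
        by (rule greedy_path[OF finB' deg deg' y m(1) order_refl])
      then obtain ps where ps: "distinct ps" "length ps = 2 * m" "last ps = y" "hd ps \<in> Domain B'"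
        "successively (\<lambda>u v. (u, v) \<in> B' \<or> (v, u) \<in> B') ps" "set ps \<subseteq> Field B'"
        by (elim exE conjE)
      have ne: "ps \<noteq> []" using ps m by auto
      have "f x = f (hd ps)" if x: "(x, y) \<in> B'" "x \<notin> set ps" for x
      proof (rule ccontr)
        assume "f x \<noteq> f (hd ps)"
        let ?qs = "ps @ [x]"
        have R: "(u, v) \<in> R" if "(u, v) \<in> B' \<or> (v, u) \<in> B'" for u v
          using that subset_trans[OF B'(1) Suc.prems(4)] sym unfolding sym_def by blast
        have "\<exists>xs. cyc R xs \<and> length xs = length ?qs + 2 * r + 1"
        proof (rule tree_cycle[OF sym disj par, where i = i])
          show "distinct ?qs" "?qs \<noteq> []" using ps x by auto
          show "successively (\<lambda>u v. (u, v) \<in> R) ?qs"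
            using ps(3) x ne R successively_mono[OF ps(5)] by (auto simp: successively_append_iff)
          have hd_in: "hd ps \<in> Domain B" "x \<in> Domain B" using ps(4) x B'(1) by auto
          have "set ps \<subseteq> Domain B \<union> Range B"
            using ps(6) Domain_mono[OF B'(1)] Range_mono[OF B'(1)] unfolding Field_def by blast
          then have fld: "set ?qs \<subseteq> Domain B \<union> Range B" using hd_in by simp
          show "set ?qs \<inter> L j = {}" if "j < i" for j
          proof -
            have "L i \<inter> L j = {}" "Range B \<inter> L j = {}" using disj[of i j] Suc.prems(6) that by auto
            then show ?thesis using fld Suc.prems(5) by blast
          qed
          show "hd ?qs \<in> L i" "last ?qs \<in> L i"
            using hd_in by (simp_all add: ne subsetD[OF Suc.prems(5)])
          show "Suc r \<le> i" by fact
          show "(par ^^ Suc r) (hd ?qs) = (par ^^ Suc r) (last ?qs)"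
            using hd_in by (intro Suc.prems(7)) (simp_all add: ne)
          show "(par ^^ r) (hd ?qs) \<noteq> (par ^^ r) (last ?qs)"
            using \<open>f x \<noteq> f (hd ps)\<close> ne by (simp add: f_def)
        qed
        moreover have "length ?qs + 2 * r + 1 = 2 * k" using ps(2) m by simp
        ultimately show False using False by metis
      qed
      then have "B'\<inverse> `` {y} \<subseteq> {x \<in> B'\<inverse> `` {y}. f x = f (hd ps)} \<union> set ps" by auto
      then have "card (B'\<inverse> `` {y}) \<le> card ({x \<in> B'\<inverse> `` {y}. f x = f (hd ps)} \<union> set ps)"
        using finB' by (intro card_mono finite_UnI finite_subset[of "{x \<in> B'\<inverse> `` {y}. f x = f (hd ps)}" "B'\<inverse> `` {y}"]) auto
      also have "\<dots> \<le> card {x \<in> B'\<inverse> `` {y}. f x = f (hd ps)} + card (set ps)" by (rule card_Un_le)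
      finally have "card (B'\<inverse> `` {y}) \<le> card {x \<in> B'\<inverse> `` {y}. f x = f (hd ps)} + 2 * m"
        using ps by (simp add: distinct_card)
      moreover have "4 * m \<le> card (B'\<inverse> `` {y})" using B'(5) y mc by (meson order.trans)
      ultimately show ?thesis by (intro exI[of _ "f (hd ps)"]) linarith
    qed
    define a where "a = (\<lambda>y. SOME a. 2 * card {x \<in> B'\<inverse> `` {y}. f x = a} \<ge> card (B'\<inverse> `` {y}))"
    have a: "\<And>y. y \<in> Range B' \<Longrightarrow> 2 * card {x \<in> B'\<inverse> `` {y}. f x = a y} \<ge> card (B'\<inverse> `` {y})"
      unfolding a_def by (rule someI_ex, rule maj)
    \<comment> \<open>Keeping only the pairs that agree with the majority label loses at most half
      of \<open>B'\<close>; this is why the density factor halves with each decrease of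
      \<open>r\<close> and starts at \<open>2 ^ r * (2 * k)\<close>.\<close>
    define B2 where "B2 = {(x, y) \<in> B'. f x = a y}"
    have finB2: "finite B2" and sub2: "B2 \<subseteq> B'" using finB' by (auto simp: B2_def intro: finite_subset)
    have B2y: "B2\<inverse> `` {y} = {x \<in> B'\<inverse> `` {y}. f x = a y}" for y by (auto simp: B2_def)
    have "card B' = (\<Sum>y\<in>Range B'. card (B'\<inverse> `` {y}))" by (rule card_rel_eq_sum_Range) fact
    also have "\<dots> \<le> (\<Sum>y\<in>Range B'. 2 * card (B2\<inverse> `` {y}))"
      unfolding B2y by (intro sum_mono a)
    also have "\<dots> = (\<Sum>y\<in>Range B2. 2 * card (B2\<inverse> `` {y}))"
    proof (intro sum.mono_neutral_right ballI)
      show "finite (Range B')" using finB' by (simp add: finite_Range)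
      show "Range B2 \<subseteq> Range B'" using sub2 by auto
      show "2 * card (B2\<inverse> `` {y}) = 0" if "y \<in> Range B' - Range B2" for y
      proof -
        have "B2\<inverse> `` {y} = {}" using that by auto
        then show ?thesis by simp
      qed
    qed
    also have "\<dots> = 2 * card B2" using card_rel_eq_sum_Range[OF finB2] by (simp add: sum_distrib_left)
    finally have half: "card B' \<le> 2 * card B2" .
    then have "B2 \<noteq> {}" using B'(2) finB' by auto
    have "card (Domain B2) \<le> card (Domain B')" "card (Range B2) \<le> card (Range B')"
      using sub2 finB' by (auto intro!: card_mono simp: finite_Domain finite_Range)
    then have "c * (card (Domain B2) + card (Range B2)) \<le> c * (card (Domain B') + card (Range B'))"
      by (intro mult_le_mono2) simp
    then have dense2: "c * (card (Domain B2) + card (Range B2)) \<le> card B2"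
      using half B'(3) by linarith
    have lab: "f x = a y" if "(x, y) \<in> B2" for x y using that by (simp add: B2_def)
    have "\<exists>z. {(x, y) \<in> B2. f x = z} \<noteq> {} \<and> card {(x, y) \<in> B2. f x = z} \<ge>
        c * (card (Domain {(x, y) \<in> B2. f x = z}) + card (Range {(x, y) \<in> B2. f x = z}))"
      by (rule dense_relation_split[of B2 f a, OF finB2 \<open>B2 \<noteq> {}\<close> lab dense2])
    then obtain z where z: "{(x, y) \<in> B2. f x = z} \<noteq> {}"
      "card {(x, y) \<in> B2. f x = z} \<ge>
        c * (card (Domain {(x, y) \<in> B2. f x = z}) + card (Range {(x, y) \<in> B2. f x = z}))"
      by (elim exE conjE)
    define B3 where "B3 = {(x, y) \<in> B2. f x = z}"
    have sub3: "B3 \<subseteq> B" using sub2 B'(1) by (auto simp: B3_def)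
    show ?thesis
    proof (rule Suc.IH)
      show "r \<le> i" using Suc.prems(1) by simp
      show "finite B3" "B3 \<subseteq> R" "Domain B3 \<subseteq> L i"
        using sub3 Suc.prems by (auto intro: finite_subset)
      show "B3 \<noteq> {}" "2 ^ r * (2 * k) * (card (Domain B3) + card (Range B3)) \<le> card B3"
        using z unfolding B3_def c_def by blast+
      show "Range B3 \<inter> L j = {}" if "j < i" for j using sub3 Suc.prems(6)[OF that] by auto
      show "(par ^^ r) x = (par ^^ r) x'" if "x \<in> Domain B3" "x' \<in> Domain B3" for x x'
        using that by (auto simp: B3_def f_def)
    qed
  qed
qed

section \<open>The even cycle theorem\<close>

text \<open>\<open>R\<close> holds both orientations of an edge: a vertex of degree below
  \<open>d\<close> takes away fewer than \<open>2 * d\<close> pairs, so its deletion preserves the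
  density bound.\<close>

lemma dense_imp_min_degree:
  fixes R :: "('a \<times> 'a) set"
  assumes "finite W" "W \<noteq> {}" "sym R" "card (R \<inter> W \<times> W) \<ge> 2 * d * card W"
  shows "\<exists>W'\<subseteq>W. W' \<noteq> {} \<and> (\<forall>v\<in>W'. card ((R \<inter> W' \<times> W') `` {v}) \<ge> d)"
  using assms
proof (induction W rule: finite_psubset_induct)
  case (psubset W)
  show ?case
  proof (cases "\<forall>v\<in>W. card ((R \<inter> W \<times> W) `` {v}) \<ge> d")
    case True
    then show ?thesis using psubset.prems by blast
  next
    case False
    then obtain v where v: "v \<in> W" "card ((R \<inter> W \<times> W) `` {v}) < d" by (meson not_le)
    define N where "N = (R \<inter> W \<times> W) `` {v}"
    define W0 where "W0 = W - {v}"
    have finN: "finite N" using psubset.hyps by (auto simp: N_def intro: finite_subset[of _ W])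
    have finW0: "finite (R \<inter> W0 \<times> W0)" using psubset.hyps by (simp add: W0_def)
    have "R \<inter> W \<times> W \<subseteq> (R \<inter> W0 \<times> W0) \<union> (Pair v ` N \<union> (\<lambda>u. (u, v)) ` N)"
      using symD[OF \<open>sym R\<close>] by (auto simp: W0_def N_def)
    then have "card (R \<inter> W \<times> W) \<le> card ((R \<inter> W0 \<times> W0) \<union> (Pair v ` N \<union> (\<lambda>u. (u, v)) ` N))"
      using finN finW0 by (intro card_mono) auto
    also have "\<dots> \<le> card (R \<inter> W0 \<times> W0) + (card (Pair v ` N) + card ((\<lambda>u. (u, v)) ` N))"
      by (meson add_left_mono card_Un_le order.trans)
    also have "\<dots> \<le> card (R \<inter> W0 \<times> W0) + (card N + card N)"
      using card_image_le[OF finN] by (intro add_left_mono add_mono) auto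
    finally have "card (R \<inter> W \<times> W) < card (R \<inter> W0 \<times> W0) + 2 * d" using v(2) by (simp add: N_def)
    moreover have "card W = Suc (card W0)"
      unfolding W0_def by (rule card_Suc_Diff1[symmetric, OF psubset.hyps v(1)])
    then have "2 * d * card W = 2 * d * card W0 + 2 * d" by simp
    ultimately have dense: "2 * d * card W0 < card (R \<inter> W0 \<times> W0)" using psubset.prems(3) by linarith
    then have "W0 \<noteq> {}" by auto
    moreover have "W0 \<subset> W" using v(1) by (auto simp: W0_def)
    ultimately have "\<exists>W'\<subseteq>W0. W' \<noteq> {} \<and> (\<forall>v\<in>W'. card ((R \<inter> W' \<times> W') `` {v}) \<ge> d)"
      using psubset.prems(2) dense by (intro psubset.IH) simp_all
    then show ?thesis using \<open>W0 \<subset> W\<close> by (meson psubset_imp_subset subset_trans)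
  qed
qed

text \<open>In the breadth-first layers around \<open>x\<close>, neither a layer nor two consecutive
  layers can span many edges, by \<open>dense_layer_imp_cycle\<close>. The edges forced by the
  degree condition need room in the next layer, so the layers grow by a factor \<open>g\<close> for
  \<open>k\<close> steps. The 5 pays for edges inside a layer and back to the previous one: with a,
  b, b' the sizes of three consecutive layers, the middle one sees at most c(2a + 3b + b') pairs,
  and a is at most b.\<close>

lemma min_degree_no_even_cycle_bound:
  fixes R :: "('a \<times> 'a) set"
  assumes W: "finite W" "R \<subseteq> W \<times> W" and sym: "sym R"
    and no_cycle: "\<nexists>xs. cyc R xs \<and> length xs = 2 * k"
    and x: "x \<in> W" and g: "g \<ge> 1"
    and deg: "\<And>v. v \<in> W \<Longrightarrow> card (R `` {v}) \<ge> 2 ^ k * (2 * k) * (5 + g)"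
  shows "g ^ k \<le> card W"
proof (cases "k = 0")
  case True
  then show ?thesis using x W by (auto simp: Suc_le_eq card_gt_0_iff)
next
  case False
  define L where "L = (\<lambda>j. {v. (x, v) \<in> R ^^ j \<and> (\<forall>i<j. (x, v) \<notin> R ^^ i)})"
  define c where "c = 2 ^ k * (2 * k)"
  have c: "c \<ge> 1" using False by (simp add: c_def)
  have L0: "L 0 = {x}" by (auto simp: L_def)
  have disj: "L a \<inter> L b = {}" if "a \<noteq> b" for a b
    using that by (cases a b rule: linorder_cases) (auto simp: L_def)
  have step: "\<exists>j\<le>Suc i. u \<in> L j" if "v \<in> L i" "(v, u) \<in> R" for u v i
  proof -
    have "(x, u) \<in> R ^^ Suc i" using that by (auto simp: L_def)
    then have "(x, u) \<in> R ^^ (LEAST j. (x, u) \<in> R ^^ j)" "(LEAST j. (x, u) \<in> R ^^ j) \<le> Suc i"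
      by (rule LeastI, rule Least_le)
    then show ?thesis
      by (intro exI[of _ "LEAST j. (x, u) \<in> R ^^ j"]) (auto simp: L_def dest: not_less_Least)
  qed
  have step': "u \<in> L (i - 1) \<or> u \<in> L i \<or> u \<in> L (Suc i)" if "v \<in> L i" "(v, u) \<in> R" for u v i
  proof -
    from step[OF that] obtain j where j: "j \<le> Suc i" "u \<in> L j" by auto
    have "(u, v) \<in> R" using that sym by (meson symD)
    then obtain j' where "j' \<le> Suc j" "v \<in> L j'" using step[OF j(2)] by auto
    then have "i \<le> Suc j" using disj[of i j'] that(1) by auto
    then have "j = i - 1 \<or> j = i \<or> j = Suc i" using j(1) by auto
    then show ?thesis using j(2) by auto
  qed
  have LW: "L j \<subseteq> W" for j
    using x W by (cases j) (auto simp: L_def)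
  have finL: "finite (L j)" for j using LW W(1) by (rule finite_subset)
  have pred: "\<exists>u. u \<in> L j \<and> (v, u) \<in> R" if "v \<in> L (Suc j)" for v j
  proof -
    have "(x, v) \<in> R ^^ Suc j" using that by (simp add: L_def)
    then obtain u where u: "(x, u) \<in> R ^^ j" "(u, v) \<in> R" by auto
    have "(x, u) \<notin> R ^^ i" if "i < j" for i
    proof
      assume "(x, u) \<in> R ^^ i"
      then have "(x, v) \<in> R ^^ Suc i" using u(2) by auto
      then show False using \<open>v \<in> L (Suc j)\<close> that unfolding L_def by blast
    qed
    then show ?thesis using u sym by (auto simp: L_def dest: symD)
  qed
  define par where "par = (\<lambda>v. SOME u. (v, u) \<in> R \<and> (\<exists>j. v \<in> L (Suc j) \<and> u \<in> L j))"
  have par: "par v \<in> L j \<and> (v, par v) \<in> R" if v: "v \<in> L (Suc j)" for j v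
  proof -
    have "\<exists>u. (v, u) \<in> R \<and> (\<exists>j. v \<in> L (Suc j) \<and> u \<in> L j)" using pred[OF v] v by blast
    then have "(v, par v) \<in> R \<and> (\<exists>j. v \<in> L (Suc j) \<and> par v \<in> L j)"
      unfolding par_def by (rule someI_ex)
    then obtain j' where "(v, par v) \<in> R" "v \<in> L (Suc j')" "par v \<in> L j'" by blast
    moreover from this have "j' = j" using disj[of "Suc j'" "Suc j"] v by auto
    ultimately show ?thesis by simp
  qed
  have root: "(par ^^ i) v = x" if "v \<in> L i" for i v
    using that
  proof (induction i arbitrary: v)
    case (Suc i)
    then show ?case using par[OF Suc.prems] by (simp add: funpow_swap1)
  qed (simp add: L0)
  have layer: "card (R \<inter> L i \<times> Y) \<le> c * (card (L i) + card Y)"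
    if i: "i < k" and Y: "finite Y" "\<And>j. j < i \<Longrightarrow> Y \<inter> L j = {}" for i Y
  proof (rule ccontr)
    define B where "B = R \<inter> L i \<times> Y"
    assume "\<not> ?thesis"
    then have big: "c * (card (L i) + card Y) < card B" by (simp add: B_def)
    then have "B \<noteq> {}" by auto
    have finB: "finite B" using finL Y by (simp add: B_def)
    have "card (Domain B) \<le> card (L i)" "card (Range B) \<le> card Y"
      using finL Y by (auto intro!: card_mono simp: B_def)
    moreover have "2 ^ i * (2 * k) \<le> c" using i by (simp add: c_def)
    ultimately have "2 ^ i * (2 * k) * (card (Domain B) + card (Range B)) \<le> c * (card (L i) + card Y)"
      by (intro mult_le_mono add_mono)
    then have dense: "2 ^ i * (2 * k) * (card (Domain B) + card (Range B)) \<le> card B" using big by linarith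
    have "\<exists>xs. cyc R xs \<and> length xs = 2 * k"
    \<comment> \<open>With \<open>r = i\<close> the common ancestor is the root \<open>x\<close> of
      the breadth-first tree.\<close>
    proof (rule dense_layer_imp_cycle[OF sym, where L = L and par = par and i = i and r = i and B = B])
      show "B \<subseteq> R" "Domain B \<subseteq> L i" by (auto simp: B_def)
      show "Range B \<inter> L j = {}" if "j < i" for j using Y(2)[OF that] by (auto simp: B_def)
      show "(par ^^ i) u = (par ^^ i) u'" if "u \<in> Domain B" "u' \<in> Domain B" for u u'
        using that root by (auto simp: B_def)
    qed (fact disj par i order_refl finB \<open>B \<noteq> {}\<close> dense)+
    then show False using no_cycle by blast
  qed
  have up: "card (R \<inter> L i \<times> (L i \<union> L (Suc i))) \<le> c * (2 * card (L i) + card (L (Suc i)))"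
    if i: "i < k" for i
  proof -
    have "card (R \<inter> L i \<times> (L i \<union> L (Suc i))) \<le> c * (card (L i) + card (L i \<union> L (Suc i)))"
      using disj finL by (intro layer i) (auto simp: Int_Un_distrib2)
    also have "\<dots> \<le> c * (card (L i) + (card (L i) + card (L (Suc i))))"
      by (intro mult_le_mono2 add_left_mono card_Un_le)
    finally show ?thesis by (simp add: mult_2 add.assoc)
  qed
  have degL: "c * (5 + g) * card (L i) \<le> card (R \<inter> L i \<times> UNIV)" for i
  proof -
    have "card (R \<inter> L i \<times> UNIV) = card (SIGMA v:L i. R `` {v})" by (rule arg_cong[of _ _ card]) auto
    also have "\<dots> = (\<Sum>v\<in>L i. card (R `` {v}))"
      using finL W by (intro card_SigmaI) (auto intro: finite_subset[of _ W])
    also have "\<dots> \<ge> (\<Sum>v\<in>L i. c * (5 + g))"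
      using LW deg unfolding c_def by (intro sum_mono) auto
    finally show ?thesis by (simp add: mult.commute)
  qed
  have grow: "g * card (L i) \<le> card (L (Suc i))" if "i < k" for i
    using that
  proof (induction i)
    case 0
    have "R \<inter> L 0 \<times> UNIV \<subseteq> R \<inter> L 0 \<times> (L 0 \<union> L (Suc 0))" using step'[of _ 0] by auto
    then have "card (R \<inter> L 0 \<times> UNIV) \<le> card (R \<inter> L 0 \<times> (L 0 \<union> L (Suc 0)))"
      using finL by (intro card_mono) auto
    then have "c * ((5 + g) * card (L 0)) \<le> c * (2 * card (L 0) + card (L (Suc 0)))"
      using up[OF 0] degL[of 0] unfolding mult.assoc by linarith
    then have "(5 + g) * card (L 0) \<le> 2 * card (L 0) + card (L (Suc 0))" using c by simp
    then show ?case by (simp add: algebra_simps)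
  next
    case (Suc i)
    let ?i = "Suc i"
    have "1 * card (L i) \<le> g * card (L i)" using g by (intro mult_le_mono1)
    then have mono: "card (L i) \<le> card (L ?i)" using Suc.IH Suc.prems by linarith
    have "R \<inter> L ?i \<times> UNIV \<subseteq> (R \<inter> L i \<times> (L i \<union> L ?i))\<inverse> \<union> R \<inter> L ?i \<times> (L ?i \<union> L (Suc ?i))"
      using step'[of _ ?i] symD[OF sym] by auto
    then have "card (R \<inter> L ?i \<times> UNIV)
        \<le> card ((R \<inter> L i \<times> (L i \<union> L ?i))\<inverse> \<union> R \<inter> L ?i \<times> (L ?i \<union> L (Suc ?i)))"
      using finL by (intro card_mono) auto
    also have "\<dots> \<le> card ((R \<inter> L i \<times> (L i \<union> L ?i))\<inverse>) + card (R \<inter> L ?i \<times> (L ?i \<union> L (Suc ?i)))"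
      by (rule card_Un_le)
    also have "\<dots> \<le> c * (2 * card (L i) + card (L ?i)) + c * (2 * card (L ?i) + card (L (Suc ?i)))"
      using up[of i] up[of ?i] Suc.prems by (simp add: card_inverse)
    finally have "c * ((5 + g) * card (L ?i)) \<le> c * (2 * card (L i) + 3 * card (L ?i) + card (L (Suc ?i)))"
      using degL[of ?i] by (simp add: algebra_simps)
    then have "(5 + g) * card (L ?i) \<le> 2 * card (L i) + 3 * card (L ?i) + card (L (Suc ?i))"
      using c by simp
    then show ?case using mono by (simp add: algebra_simps)
  qed
  have "g ^ i \<le> card (L i)" if "i \<le> k" for i
    using that
  proof (induction i)
    case (Suc i)
    have "g * g ^ i \<le> g * card (L i)" using Suc by simp
    also have "\<dots> \<le> card (L (Suc i))" using grow[of i] Suc.prems by simp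
    finally show ?case by simp
  qed (simp add: L0)
  then have "g ^ k \<le> card (L k)" by simp
  also have "\<dots> \<le> card W" using LW W(1) by (intro card_mono)
  finally show ?thesis .
qed

text \<open>The theorem of Bondy and Simonovits. A denser relation has a part of minimum degree at
  least \<open>C * (5 + g)\<close>, whose breadth-first layers would need more vertices than there
  are.\<close>

theorem even_cycle_bound:
  assumes "k \<ge> 1"
  obtains c :: real where "c > 0" "\<And>(W :: 'a set) R. finite W \<Longrightarrow> R \<subseteq> W \<times> W \<Longrightarrow> sym R \<Longrightarrow>
    (\<nexists>xs. cyc R xs \<and> length xs = 2 * k) \<Longrightarrow> real (card R) \<le> c * real (card W) powr (1 + 1 / real k)"
proof
  define C where "C = 2 ^ k * (2 * k)"
  show "14 * real C > 0" using assms by (simp add: C_def)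
  fix W :: "'a set" and R
  assume W: "finite W" "R \<subseteq> W \<times> W" and sym: "sym R"
    and no_cycle: "\<nexists>xs. cyc R xs \<and> length xs = 2 * k"
  define N where "N = card W"
  show "real (card R) \<le> 14 * real C * real (card W) powr (1 + 1 / real k)"
  proof (cases "W = {}")
    case True
    then show ?thesis using W by simp
  next
    case False
    then have N: "N \<ge> 1" using W(1) by (simp add: N_def Suc_le_eq card_gt_0_iff)
    \<comment> \<open>The least integer whose \<open>k\<close>-th power exceeds
      \<open>N\<close>.\<close>
    define g where "g = Suc (nat \<lfloor>real N powr (1 / real k)\<rfloor>)"
    have root1: "real N powr (1 / real k) \<ge> 1" using N by (simp add: ge_one_powr_ge_zero)
    have g: "real N powr (1 / real k) < real g" "real g \<le> real N powr (1 / real k) + 1"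
      unfolding g_def using root1 by linarith+
    have "real N = (real N powr (1 / real k)) ^ k"
      using N assms by (simp add: powr_realpow[symmetric] powr_powr)
    also have "\<dots> < real g ^ k" using g(1) assms by (intro power_strict_mono) auto
    finally have gk: "N < g ^ k" by (metis of_nat_less_iff of_nat_power)
    define d where "d = C * (5 + g)"
    have "card R < 2 * d * N"
    proof (rule ccontr)
      assume "\<not> ?thesis"
      moreover have "R \<inter> W \<times> W = R" using W by auto
      ultimately obtain W' where W': "W' \<subseteq> W" "W' \<noteq> {}"
        "\<forall>v\<in>W'. card ((R \<inter> W' \<times> W') `` {v}) \<ge> d"
        using dense_imp_min_degree[OF W(1) False sym, of d] by (auto simp: N_def)
      obtain x where "x \<in> W'" using W' by auto
      have "g ^ k \<le> card W'"
      proof (rule min_degree_no_even_cycle_bound)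
        show "finite W'" using W' W finite_subset by blast
        show "sym (R \<inter> W' \<times> W')" using sym by (auto simp: sym_def)
        show "\<nexists>xs. cyc (R \<inter> W' \<times> W') xs \<and> length xs = 2 * k"
          using no_cycle cyc_mono[of "R \<inter> W' \<times> W'" R] by blast
        show "2 ^ k * (2 * k) * (5 + g) \<le> card ((R \<inter> W' \<times> W') `` {v})" if "v \<in> W'" for v
          using W'(3) that by (simp add: d_def C_def)
      qed (use \<open>x \<in> W'\<close> in \<open>auto simp: g_def\<close>)
      also have "\<dots> \<le> N" using W' W(1) by (simp add: N_def card_mono)
      finally show False using gk by simp
    qed
    then have "real (card R) \<le> real (2 * d * N)" by linarith
    also have "\<dots> = 2 * real C * real N * (5 + real g)" by (simp add: d_def)
    \<comment> \<open>Here \<open>g\<close> is at most the root plus 1 and the root is at least 1,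
      so \<open>5 + g\<close> is at most 7 times the root; with the factor 2 this gives the
      14.\<close>
    also have "\<dots> \<le> 2 * real C * real N * (7 * real N powr (1 / real k))"
      using g(2) root1 by (intro mult_left_mono) auto
    also have "\<dots> = 14 * real C * real N powr (1 + 1 / real k)"
      using N by (simp add: powr_add)
    finally show ?thesis by (simp add: N_def)
  qed
qed

section \<open>Products of transpositions\<close>

definition transps :: "nat \<Rightarrow> (nat \<Rightarrow> nat) set" where
  "transps n = {Transposition.transpose a b | a b. a \<in> {1..n} \<and> b \<in> {1..n} \<and> a \<noteq> b}"

text \<open>For transpositions this is disjointness of supports. Commutation is the form that
  matters: in the host graph \<open>s \<circ> t \<circ> v\<close> is then a common neighbour of
  \<open>s \<circ> v\<close> and \<open>t \<circ> v\<close>.\<close>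

definition ortho :: "('a \<Rightarrow> 'a) \<Rightarrow> ('a \<Rightarrow> 'a) \<Rightarrow> bool" where
  "ortho s t \<longleftrightarrow> s \<noteq> t \<and> s \<circ> t = t \<circ> s"

lemma ortho_sym: "ortho s t \<Longrightarrow> ortho t s"
  by (auto simp: ortho_def)

lemma transps_involutory: "t \<in> transps n \<Longrightarrow> t (t x) = x"
  by (auto simp: transps_def)

lemma transps_comp_self: "t \<in> transps n \<Longrightarrow> t \<circ> t = id"
  by (auto simp: transps_def)

lemma transps_cancel: "t \<in> transps n \<Longrightarrow> t \<circ> (t \<circ> v) = v"
  by (auto simp: fun_eq_iff transps_involutory)

lemma transps_moves: "t \<in> transps n \<Longrightarrow> \<exists>a. t a \<noteq> a"
  by (auto simp: transps_def) (metis transpose_apply_first)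

lemma transps_eqI: "t \<in> transps n \<Longrightarrow> t a = b \<Longrightarrow> a \<noteq> b \<Longrightarrow> t = Transposition.transpose a b"
  by (auto simp: transps_def transpose_def transpose_commute split: if_splits)

lemma transps_unique:
  "s \<in> transps n \<Longrightarrow> t \<in> transps n \<Longrightarrow> s a = t a \<Longrightarrow> t a \<noteq> a \<Longrightarrow> s = t"
  using transps_eqI by metis

text \<open>If both moved \<open>a\<close>, commutation would make \<open>s\<close> move
  \<open>t a\<close> as well; then \<open>t a\<close> would be the other point of \<open>s\<close>,
  and the two transpositions would agree.\<close>

lemma ortho_fixes:
  assumes "s \<in> transps n" "t \<in> transps n" "ortho s t" "s a \<noteq> a"
  shows "t a = a"
proof (rule ccontr)
  assume ta: "t a \<noteq> a"
  have "s (t a) \<noteq> t a"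
  proof
    assume "s (t a) = t a"
    then have "t (s a) = t a" using assms(3) by (metis comp_apply ortho_def)
    then show False using assms(2,4) transps_involutory by metis
  qed
  moreover have "s = Transposition.transpose a (s a)" using assms by (metis transps_eqI)
  ultimately have "t a = s a" using ta by (metis transpose_apply_other)
  then show False using transps_unique[OF assms(1,2)] assms(3) ta by (metis ortho_def)
qed

lemma sign_transps: "t \<in> transps n \<Longrightarrow> permutation t \<and> sign t = -1"
  by (auto simp: transps_def sign_swap_id permutation_swap_id)

text \<open>The signs differ. This separates the vertices one step from the base of a local graph
  from those two steps away.\<close>

lemma transps_comp_parity:
  assumes "s \<in> transps n" "t \<in> transps n" "u \<in> transps n"
  shows "u \<noteq> s \<circ> t"
proof
  assume "u = s \<circ> t"
  then have "sign u = sign s * sign t" using sign_compose sign_transps assms by metis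
  then show False using sign_transps assms by simp
qed

lemma transps_comp_parity5:
  assumes "i \<in> transps n" "j \<in> transps n" "s \<in> transps n" "t \<in> transps n" "u \<in> transps n"
  shows "u \<noteq> s \<circ> t \<circ> i \<circ> j"
proof
  assume "u = s \<circ> t \<circ> i \<circ> j"
  then have "sign u = sign s * sign t * sign i * sign j"
    using assms[THEN sign_transps] by (simp add: sign_compose permutation_compose)
  then show False using assms[THEN sign_transps] by simp
qed

text \<open>Disjoint supports let only one factor act on \<open>a\<close>, and a transposition is
  determined by the image of one point that it moves.\<close>

lemma ortho_swap_cases:
  assumes "s \<in> transps n" "t \<in> transps n" "i \<in> transps n" "ortho s t"
    and "s (t a) = i a" "i a \<noteq> a"
  shows "s = i \<or> t = i"
proof (cases "t a = a")
  case True
  then show ?thesis using assms transps_unique by metis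
next
  case False
  then have "t (t a) \<noteq> t a" using assms(2) transps_involutory by metis
  then have "s (t a) = t a" using ortho_fixes assms ortho_sym by metis
  then show ?thesis using assms transps_unique by metis
qed

text \<open>Commutation is needed: a 3-cycle has three factorisations into two transpositions.\<close>

lemma ortho_comp_unique:
  assumes T: "j \<in> transps n" "k \<in> transps n" "s \<in> transps n" "t \<in> transps n"
    and "ortho j k" "j \<circ> k = s \<circ> t"
  shows "(s = j \<and> t = k) \<or> (s = k \<and> t = j)"
proof -
  obtain a where a: "j a \<noteq> a" using transps_moves T by blast
  let ?b = "j a"
  have b: "j ?b = a" using T transps_involutory by metis
  have k: "k a = a" "k ?b = ?b"
    using ortho_fixes[OF T(1,2) \<open>ortho j k\<close>] a b by metis+
  have st: "s (t x) = j (k x)" for x using assms(6) by (metis comp_apply)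
  have jk: "j \<circ> k = k \<circ> j" using assms(5) by (simp add: ortho_def)
  consider "t a = a" | "t a = ?b" | "t a \<noteq> a" "t a \<noteq> ?b" by blast
  then show ?thesis
  proof cases
    case 1
    then have "s = j" using st[of a] k a T transps_unique by metis
    then have "j \<circ> (j \<circ> k) = j \<circ> (j \<circ> t)" using assms(6) by simp
    then have "k = t" using transps_cancel[OF T(1)] by metis
    then show ?thesis using \<open>s = j\<close> by simp
  next
    case 2
    then have "t = j" using a T transps_unique by metis
    then have "k \<circ> j \<circ> j = s \<circ> j \<circ> j" using assms(6) jk by metis
    then have "k = s" using transps_comp_self[OF T(1)] by (simp add: comp_assoc)
    then show ?thesis using \<open>t = j\<close> by simp
  next
    \<comment> \<open>Here \<open>s\<close> would have to swap \<open>t a\<close> with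
      \<open>j a\<close>, so that \<open>s \<circ> t\<close> sends \<open>j a\<close> to
      \<open>t a\<close> instead of back to \<open>a\<close>.\<close>
    case 3
    let ?x = "t a"
    have "t ?b = ?b" using transps_eqI[OF T(4), of a ?x] 3 a by (metis transpose_apply_other)
    moreover have "s ?x = ?b" using st[of a] k by metis
    then have "s ?b = ?x" using T transps_involutory by metis
    ultimately have "?x = j (k ?b)" using st[of ?b] by metis
    then show ?thesis using k b 3 by metis
  qed
qed

text \<open>For common vertices \<open>j \<circ> i \<circ> w = j' \<circ> i' \<circ> w\<close> of
  two lifted cycles with bases \<open>i \<circ> w\<close> and \<open>i' \<circ> w\<close>: a point
  moved by \<open>i'\<close> is fixed by \<open>i\<close> and \<open>j\<close>, so \<open>j'\<close>
  must undo \<open>i'\<close> there. Only the vertex \<open>w\<close> remains.\<close>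

lemma ortho_overlap_1:
  assumes T: "i \<in> transps n" "j \<in> transps n" "i' \<in> transps n" "j' \<in> transps n"
    and o: "ortho i' i" "ortho i' j"
    and eq: "j \<circ> i = j' \<circ> i'"
  shows "j = i \<and> j' = i'"
proof -
  obtain a where a: "i' a \<noteq> a" using transps_moves T by blast
  have "i a = a" "j a = a" using ortho_fixes[OF T(3)] T o a by metis+
  then have "j' (i' a) = a" using eq by (metis comp_apply)
  then have "j' = i'" using a T transps_unique transps_involutory by metis
  then have "j \<circ> i = id" using eq transps_comp_self T by metis
  then have "j \<circ> i \<circ> i = i" by simp
  then have "j = i" using transps_comp_self[OF T(1)] by (simp add: comp_assoc)
  then show ?thesis using \<open>j' = i'\<close> by simp
qed

text \<open>The counterpart for vertices two steps from both bases. A point moved by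
  \<open>i'\<close> shows that \<open>j'\<close> or \<open>k'\<close> equals \<open>i'\<close>; both
  sides then reduce to a single transposition \<open>c\<close>. So the common vertex is
  \<open>c \<circ> w\<close>, and \<open>c\<close> is adjacent to \<open>i\<close> on one cycle and
  to \<open>i'\<close> on the other.\<close>

lemma ortho_overlap_2:
  assumes T: "i \<in> transps n" "j \<in> transps n" "k \<in> transps n"
    and T': "i' \<in> transps n" "j' \<in> transps n" "k' \<in> transps n"
    and o: "ortho i' i" "ortho i' j" "ortho i' k" "ortho j k" "ortho j' k'"
    and eq: "j \<circ> k \<circ> i = j' \<circ> k' \<circ> i'"
  shows "\<exists>c. {j, k} = {i, c} \<and> {j', k'} = {i', c}"
proof -
  have main: "{j, k} = {i, c}" if "c \<in> transps n" "j \<circ> k \<circ> i = c" for c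
  proof -
    have "j \<circ> k \<circ> (i \<circ> i) = c \<circ> i" using that by (metis comp_assoc)
    then have "j \<circ> k = c \<circ> i" using transps_comp_self[OF T(1)] by simp
    then show ?thesis using ortho_comp_unique[OF T(2,3) that(1) T(1) o(4)] by auto
  qed
  obtain a where a: "i' a \<noteq> a" using transps_moves T' by blast
  let ?b = "i' a"
  have b: "i' ?b = a" using T' transps_involutory by metis
  have "i a = a" "j a = a" "k a = a" using ortho_fixes[OF T'(1)] T o a by metis+
  then have "j' (k' ?b) = i' ?b" using eq b by (metis comp_apply)
  then consider "j' = i'" | "k' = i'"
    using ortho_swap_cases[OF T'(2,3,1) o(5)] a b by metis
  then show ?thesis
  proof cases
    case 1
    then have "j' \<circ> k' \<circ> i' = k' \<circ> (i' \<circ> i')" using o(5) by (metis comp_assoc ortho_def)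
    then have "j \<circ> k \<circ> i = k'" using eq transps_comp_self[OF T'(1)] by simp
    then show ?thesis using main[OF T'(3)] 1 by blast
  next
    case 2
    then have "j' \<circ> k' \<circ> i' = j' \<circ> (i' \<circ> i')" by (simp add: comp_assoc)
    then have "j \<circ> k \<circ> i = j'" using eq transps_comp_self[OF T'(1)] by simp
    then show ?thesis using main[OF T'(2)] 2 by blast
  qed
qed

section \<open>Counting transpositions and commuting pairs\<close>

lemma finite_transps: "finite (transps n)"
proof -
  have "transps n \<subseteq> (\<lambda>(a, b). Transposition.transpose a b) ` ({1..n} \<times> {1..n})"
    by (auto simp: transps_def)
  then show ?thesis by (rule finite_subset) simp
qed

lemma card_transps: "card (transps n) = n choose 2"
proof -
  define g where "g = (\<lambda>t::nat \<Rightarrow> nat. {a. t a \<noteq> a})"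
  have g: "g (Transposition.transpose a b) = {a, b}" if "a \<noteq> b" for a b
    using that by (auto simp: g_def transpose_def)
  have "bij_betw g (transps n) {K. K \<subseteq> {1..n} \<and> card K = 2}"
  proof (intro bij_betw_imageI inj_onI)
    fix s t assume "s \<in> transps n" "t \<in> transps n" "g s = g t"
    then show "s = t"
      by (auto simp: transps_def g doubleton_eq_iff transpose_commute)
  next
    show "g ` transps n = {K. K \<subseteq> {1..n} \<and> card K = 2}"
    proof (intro equalityI subsetI)
      fix K assume "K \<in> g ` transps n"
      then show "K \<in> {K. K \<subseteq> {1..n} \<and> card K = 2}" by (auto simp: transps_def g)
    next
      fix K assume "K \<in> {K. K \<subseteq> {1..n} \<and> card K = 2}"
      then obtain a b where "K = {a, b}" "a \<noteq> b" "a \<in> {1..n}" "b \<in> {1..n}"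
        by (auto simp: card_2_iff)
      then show "K \<in> g ` transps n"
        by (intro image_eqI[of _ _ "Transposition.transpose a b"]) (auto simp: transps_def g)
    qed
  qed
  then show ?thesis using n_subsets[of "{1..n}" 2] bij_betw_same_card by fastforce
qed

text \<open>A transposition that equals or fails to commute with (a b) involves \<open>a\<close> or
  \<open>b\<close>, with at most \<open>n\<close> choices for its other point.\<close>

lemma card_not_ortho:
  assumes "i \<in> transps n"
  shows "card {t \<in> transps n. \<not> ortho i t} \<le> 2 * n"
proof -
  obtain a b where ab: "i = Transposition.transpose a b" "a \<noteq> b" using assms by (auto simp: transps_def)
  have "{t \<in> transps n. \<not> ortho i t} \<subseteq> Transposition.transpose a ` {1..n} \<union> Transposition.transpose b ` {1..n}"
  proof
    fix t assume t: "t \<in> {t \<in> transps n. \<not> ortho i t}"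
    then obtain c d where cd: "t = Transposition.transpose c d" "c \<noteq> d" "c \<in> {1..n}" "d \<in> {1..n}"
      by (auto simp: transps_def)
    have "c \<in> {a, b} \<or> d \<in> {a, b}"
    proof (rule ccontr)
      assume ne: "\<not> ?thesis"
      then have ne': "a \<noteq> c" "a \<noteq> d" "b \<noteq> c" "b \<noteq> d" by auto
      then have "i \<circ> t = t \<circ> i" unfolding ab cd by (simp add: fun_eq_iff transpose_def)
      moreover have "i \<noteq> t"
      proof
        assume "i = t"
        then have "i a = t a" by simp
        then show False using ab ne' by (simp add: cd(1))
      qed
      ultimately show False using t by (simp add: ortho_def)
    qed
    then consider "c = a" | "c = b" | "d = a" | "d = b" by blast
    then show "t \<in> Transposition.transpose a ` {1..n} \<union> Transposition.transpose b ` {1..n}"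
    proof cases
      case 1
      then show ?thesis using cd by (metis UnI1 imageI)
    next
      case 2
      then show ?thesis using cd by (metis UnI2 imageI)
    next
      case 3
      then show ?thesis using cd by (metis UnI1 imageI transpose_commute)
    next
      case 4
      then show ?thesis using cd by (metis UnI2 imageI transpose_commute)
    qed
  qed
  then have "card {t \<in> transps n. \<not> ortho i t}
      \<le> card (Transposition.transpose a ` {1..n} \<union> Transposition.transpose b ` {1..n})"
    by (intro card_mono) auto
  also have "\<dots> \<le> card (Transposition.transpose a ` {1..n}) + card (Transposition.transpose b ` {1..n})"
    by (rule card_Un_le)
  also have "\<dots> \<le> card {1..n} + card {1..n}" by (intro add_mono card_image_le) auto
  finally show ?thesis by simp
qed

section \<open>Local graphs and the cycles they produce\<close>

text \<open>Kept as a symmetric relation, so \<open>card\<close> counts every edge twice. The edges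
  from \<open>v\<close> to \<open>i \<circ> v\<close> and \<open>t \<circ> v\<close> may or may not
  belong to \<open>F\<close>.\<close>

definition local_graph :: "(nat \<Rightarrow> nat) set set \<Rightarrow> nat \<Rightarrow> (nat \<Rightarrow> nat) \<Rightarrow> ((nat \<Rightarrow> nat) \<times> (nat \<Rightarrow> nat)) set" where
  "local_graph F n v = {(i, t). i \<in> transps n \<and> t \<in> transps n \<and> ortho i t \<and>
     {i \<circ> v, i \<circ> t \<circ> v} \<in> F \<and> {t \<circ> v, i \<circ> t \<circ> v} \<in> F}"

lemma local_graphD:
  assumes "(i, t) \<in> local_graph F n v"
  shows "i \<in> transps n" "t \<in> transps n" "ortho i t" "i \<circ> t = t \<circ> i"
    "{i \<circ> v, i \<circ> t \<circ> v} \<in> F" "{i \<circ> t \<circ> v, t \<circ> v} \<in> F"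
  using assms by (auto simp: local_graph_def ortho_def insert_commute)

lemma sym_local_graph: "sym (local_graph F n v)"
  by (auto simp: sym_def local_graph_def ortho_def)

lemma local_graph_subset: "local_graph F n v \<subseteq> transps n \<times> transps n"
  by (auto simp: local_graph_def)

lemma finite_local_graph: "finite (local_graph F n v)"
  using local_graph_subset finite_transps by (meson finite_SigmaI finite_subset)

text \<open>The lift of a path of a local graph at \<open>v\<close>: between
  \<open>x \<circ> v\<close> and \<open>y \<circ> v\<close> stands their common neighbour
  \<open>x \<circ> y \<circ> v\<close>.\<close>

fun zigzag :: "('b \<Rightarrow> 'c) \<Rightarrow> ('c \<Rightarrow> 'c) list \<Rightarrow> ('b \<Rightarrow> 'c) list" where
  "zigzag v [] = []"
| "zigzag v [x] = [x \<circ> v]"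
| "zigzag v (x # y # xs) = (x \<circ> v) # (x \<circ> y \<circ> v) # zigzag v (y # xs)"

lemma zigzag_eq_Nil_iff [simp]: "zigzag v xs = [] \<longleftrightarrow> xs = []"
  by (cases "(v, xs)" rule: zigzag.cases) auto

lemma hd_zigzag: "xs \<noteq> [] \<Longrightarrow> hd (zigzag v xs) = hd xs \<circ> v"
  by (cases "(v, xs)" rule: zigzag.cases) auto

lemma last_zigzag: "xs \<noteq> [] \<Longrightarrow> last (zigzag v xs) = last xs \<circ> v"
  by (induction v xs rule: zigzag.induct) auto

lemma length_zigzag: "length (zigzag v xs) = 2 * length xs - 1"
  by (induction v xs rule: zigzag.induct) auto

lemma set_zigzag:
  "set (zigzag v xs) = (\<lambda>x. x \<circ> v) ` set xs \<union> (\<lambda>(x, y). x \<circ> y \<circ> v) ` set (zip xs (tl xs))"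
  by (induction v xs rule: zigzag.induct) auto

lemma in_set_zigzag_iff:
  "p \<in> set (zigzag v xs) \<longleftrightarrow>
    (\<exists>x\<in>set xs. p = x \<circ> v) \<or> (\<exists>a b. (a, b) \<in> set (zip xs (tl xs)) \<and> p = a \<circ> b \<circ> v)"
  by (auto simp: set_zigzag image_iff)

lemma successively_zigzag:
  assumes "successively (\<lambda>x y. (x, y) \<in> local_graph F n v) xs"
  shows "successively (\<lambda>p q. {p, q} \<in> F) (zigzag v xs)"
  using assms
proof (induction v xs rule: zigzag.induct)
  case (3 v x y xs)
  then have "(x, y) \<in> local_graph F n v" by simp
  from local_graphD(5,6)[OF this] show ?case
    using 3 by (simp add: successively_Cons hd_zigzag)
qed auto

lemma successively_zip:
  assumes "successively P xs" "(x, y) \<in> set (zip xs (tl xs))"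
  shows "P x y"
  using assms by (induction P xs rule: successively.induct) auto

lemma comp_right_cancel: "surj v \<Longrightarrow> f \<circ> v = g \<circ> v \<longleftrightarrow> f = g"
  by (metis comp_assoc comp_id surj_iff)

text \<open>Parity keeps the entries \<open>x \<circ> v\<close> apart from the entries
  \<open>x \<circ> y \<circ> v\<close>. Among the latter, a commuting product determines its
  factors, so a repetition would make \<open>x\<close> occur again later in the list.\<close>

lemma distinct_zigzag:
  assumes "successively (\<lambda>x y. (x, y) \<in> local_graph F n v) xs" "set xs \<subseteq> transps n"
    "distinct xs" "surj v"
  shows "distinct (zigzag v xs)"
  using assms
proof (induction v xs rule: zigzag.induct)
  case (3 v x y xs)
  let ?ys = "y # xs"
  have xy: "(x, y) \<in> local_graph F n v" using 3 by simp
  have T: "x \<in> transps n" "y \<in> transps n" using 3 by auto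
  have pair: "a \<in> transps n \<and> b \<in> transps n \<and> ortho a b \<and> a \<in> set ?ys \<and> b \<in> set ?ys"
    if "(a, b) \<in> set (zip ?ys (tl ?ys))" for a b
  proof -
    have "(a, b) \<in> local_graph F n v"
      using successively_zip[of "\<lambda>x y. (x, y) \<in> local_graph F n v" ?ys a b] 3(2) that by simp
    moreover have "a \<in> set ?ys" "b \<in> set ?ys"
      using set_zip_leftD[OF that] set_zip_rightD[OF that] by auto
    ultimately show ?thesis using local_graphD by blast
  qed
  have "x \<circ> v \<noteq> a \<circ> v" if "a \<in> set ?ys" for a
    using that 3 comp_right_cancel[OF 3(5)] by auto
  moreover have "x \<circ> v \<noteq> a \<circ> b \<circ> v" if "(a, b) \<in> set (zip ?ys (tl ?ys))" for a b
    using pair[OF that] T comp_right_cancel[OF 3(5)] transps_comp_parity by metis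
  ultimately have "x \<circ> v \<notin> set (zigzag v ?ys)" unfolding in_set_zigzag_iff by blast
  moreover have "x \<circ> y \<circ> v \<noteq> a \<circ> v" if "a \<in> set ?ys" for a
    using that 3(3) T comp_right_cancel[OF 3(5)] transps_comp_parity by (metis list.set_intros(2) subsetD)
  moreover have "x \<circ> y \<circ> v \<noteq> a \<circ> b \<circ> v" if "(a, b) \<in> set (zip ?ys (tl ?ys))" for a b
  proof
    assume "x \<circ> y \<circ> v = a \<circ> b \<circ> v"
    then have "x \<circ> y = a \<circ> b" using comp_right_cancel[OF 3(5)] by metis
    then have "x = a \<or> x = b"
      using ortho_comp_unique[OF T _ _ local_graphD(3)[OF xy]] pair[OF that] by metis
    then show False using pair[OF that] 3(4) by auto
  qed
  ultimately have "x \<circ> v \<notin> set (zigzag v ?ys)" "x \<circ> y \<circ> v \<notin> set (zigzag v ?ys)"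
    unfolding in_set_zigzag_iff by blast+
  moreover have "x \<circ> v \<noteq> x \<circ> y \<circ> v"
    using T comp_right_cancel[OF 3(5)] transps_comp_parity by metis
  moreover have "distinct (zigzag v ?ys)" using 3 by simp
  ultimately show ?case by simp
qed auto

section \<open>Closed lists and their lifts\<close>

lemma zip_tl_nth:
  assumes "(x, y) \<in> set (zip xs (tl xs))"
  obtains j where "Suc j < length xs" "x = xs ! j" "y = xs ! Suc j"
proof -
  obtain j where "j < length (zip xs (tl xs))" "zip xs (tl xs) ! j = (x, y)"
    using assms by (metis in_set_conv_nth)
  then show ?thesis by (intro that[of j]) (auto simp: nth_tl)
qed

lemma zip_tl_last:
  assumes "(x, y) \<in> set (zip xs (tl xs))" "distinct xs"
  shows "x \<noteq> last xs" "y = last xs \<Longrightarrow> x = last (butlast xs)" "y \<noteq> hd xs"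
proof -
  obtain j where j: "Suc j < length xs" "x = xs ! j" "y = xs ! Suc j"
    using assms(1) by (rule zip_tl_nth)
  have ne: "xs \<noteq> []" using j by auto
  show "x \<noteq> last xs"
    using j assms(2) ne by (auto simp: last_conv_nth nth_eq_iff_index_eq)
  show "y \<noteq> hd xs"
    using j assms(2) ne by (auto simp: hd_conv_nth nth_eq_iff_index_eq)
  show "x = last (butlast xs)" if "y = last xs"
  proof -
    have "Suc j = length xs - 1"
      using that j assms(2) ne by (auto simp: last_conv_nth nth_eq_iff_index_eq)
    then have "j = length (butlast xs) - 1" by simp
    moreover have "length (butlast xs) > 0" using j(1) by simp
    then have "butlast xs \<noteq> []" unfolding length_greater_0_conv .
    ultimately have "butlast xs \<noteq> []" "j = length (butlast xs) - 1" by auto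
    then show ?thesis using j by (simp add: last_conv_nth nth_butlast)
  qed
qed

lemma last_butlast_neq_hd:
  assumes "distinct xs" "3 \<le> length xs"
  shows "last (butlast xs) \<noteq> hd xs" "last (butlast xs) \<noteq> last xs" "hd xs \<noteq> last xs"
proof -
  obtain x ys z w where xs: "xs = x # ys @ [z, w]"
  proof -
    obtain zs w where zs: "xs = zs @ [w]" using assms by (cases xs rule: rev_cases) auto
    obtain us z where us: "zs = us @ [z]" using assms zs by (cases zs rule: rev_cases) auto
    obtain x ys where "us = x # ys" using assms zs us by (cases us) auto
    then show ?thesis using that zs us by simp
  qed
  show "last (butlast xs) \<noteq> hd xs" "last (butlast xs) \<noteq> last xs" "hd xs \<noteq> last xs"
    using assms(1) by (auto simp: xs butlast_append)
qed

definition cyclic_pairs :: "'a list \<Rightarrow> ('a \<times> 'a) set" where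
  "cyclic_pairs xs = insert (last xs, hd xs) (set (zip xs (tl xs)))"

lemma cyclic_pairs_cyc: "cyc R xs \<Longrightarrow> (x, y) \<in> cyclic_pairs xs \<Longrightarrow> (x, y) \<in> R"
  by (auto simp: cyclic_pairs_def cyc_def dest: successively_zip)

lemma cyclic_pairs_set:
  assumes "xs \<noteq> []" "(x, y) \<in> cyclic_pairs xs"
  shows "x \<in> set xs \<and> y \<in> set xs"
  using assms by (auto simp: cyclic_pairs_def elim: zip_tl_nth)

lemma cyclic_pairs_last:
  assumes "(x, y) \<in> cyclic_pairs xs" "distinct xs" "{x, y} = {last xs, c}"
  shows "c = hd xs \<or> c = last (butlast xs)"
  using assms zip_tl_last[of x y xs] by (auto simp: cyclic_pairs_def doubleton_eq_iff)

text \<open>The vertex of the closing pair comes first. For \<open>v = i \<circ> w\<close> with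
  \<open>i = last xs\<close> and \<open>t = hd xs\<close>, the list then runs from
  \<open>t \<circ> w\<close> to \<open>w\<close>, and its closing edge is the one along which two
  lifts are glued.\<close>

definition lift_cycle :: "('b \<Rightarrow> 'c) \<Rightarrow> ('c \<Rightarrow> 'c) list \<Rightarrow> ('b \<Rightarrow> 'c) list" where
  "lift_cycle v xs = (last xs \<circ> hd xs \<circ> v) # zigzag v xs"

lemma in_set_lift_cycle_iff:
  "p \<in> set (lift_cycle v xs) \<longleftrightarrow>
    (\<exists>x\<in>set xs. p = x \<circ> v) \<or> (\<exists>a b. (a, b) \<in> cyclic_pairs xs \<and> p = a \<circ> b \<circ> v)"
  by (auto simp: lift_cycle_def cyclic_pairs_def in_set_zigzag_iff)

lemma cyc_subset:
  assumes "cyc R xs" "R \<subseteq> W \<times> W"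
  shows "set xs \<subseteq> W"
proof
  fix x assume "x \<in> set xs"
  then obtain j where j: "j < length xs" "x = xs ! j" by (metis in_set_conv_nth)
  show "x \<in> W"
  proof (cases "Suc j < length xs")
    case True
    then have "(xs ! j, xs ! Suc j) \<in> R"
      using assms by (auto simp: cyc_def successively_conv_nth)
    then show ?thesis using j assms(2) by blast
  next
    case False
    then have "x = last xs" using j assms by (auto simp: cyc_def last_conv_nth intro: arg_cong[of _ _ "(!) xs"])
    then show ?thesis using assms by (auto simp: cyc_def)
  qed
qed

lemma cyc_local_graph_transps: "cyc (local_graph F n v) xs \<Longrightarrow> set xs \<subseteq> transps n"
  using cyc_subset local_graph_subset by blast

text \<open>By \<open>ortho_comp_unique\<close> the closing vertex can only repeat the vertex of a
  consecutive pair with the same two members, and from length 3 on there is no such pair.\<close>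

lemma distinct_lift_cycle:
  assumes xs: "cyc (local_graph F n v) xs" "3 \<le> length xs" and v: "surj v"
  shows "distinct (lift_cycle v xs)"
proof -
  have T: "set xs \<subseteq> transps n" using cyc_local_graph_transps xs by blast
  have d: "distinct xs" "xs \<noteq> []" using xs by (auto simp: cyc_def)
  have lh: "(last xs, hd xs) \<in> local_graph F n v" using xs by (simp add: cyc_def)
  have "last xs \<circ> hd xs \<circ> v \<noteq> a \<circ> v" if "a \<in> set xs" for a
    using that T local_graphD(1,2)[OF lh] comp_right_cancel[OF v] transps_comp_parity by (metis subsetD)
  moreover have "last xs \<circ> hd xs \<circ> v \<noteq> a \<circ> b \<circ> v" if ab: "(a, b) \<in> set (zip xs (tl xs))" for a b
  proof
    assume "last xs \<circ> hd xs \<circ> v = a \<circ> b \<circ> v"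
    then have "last xs \<circ> hd xs = a \<circ> b" using comp_right_cancel[OF v] by metis
    moreover have "(a, b) \<in> local_graph F n v"
      using cyclic_pairs_cyc[OF xs(1)] ab by (simp add: cyclic_pairs_def)
    ultimately have "(a = last xs \<and> b = hd xs) \<or> (a = hd xs \<and> b = last xs)"
      using ortho_comp_unique[of "last xs" n "hd xs"] local_graphD[OF lh] local_graphD by metis
    then show False using zip_tl_last[OF ab d(1)] last_butlast_neq_hd[OF d(1) xs(2)] by metis
  qed
  moreover have "distinct (zigzag v xs)"
    using xs(1) T d(1) v by (intro distinct_zigzag[where F = F and n = n]) (simp_all add: cyc_def)
  ultimately show ?thesis by (auto simp: lift_cycle_def in_set_zigzag_iff)
qed

lemma has_cycleI:
  assumes "distinct vs" "successively (\<lambda>p q. {p, q} \<in> F) vs" "vs \<noteq> []" "{last vs, hd vs} \<in> F"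
  shows "has_cycle F (length vs)"
proof -
  have "{vs ! i, vs ! ((i + 1) mod length vs)} \<in> F" if "i < length vs" for i
  proof (cases "Suc i < length vs")
    case True
    then show ?thesis using assms by (simp add: successively_conv_nth)
  next
    case False
    then have "i = length vs - 1" using that by simp
    then show ?thesis using assms by (simp add: last_conv_nth hd_conv_nth)
  qed
  then show ?thesis using assms(1) unfolding has_cycle_def by blast
qed

lemma lift_cycle_edges:
  assumes "cyc (local_graph F n v) xs"
  shows "successively (\<lambda>p q. {p, q} \<in> F) (lift_cycle v xs)"
    "{last (lift_cycle v xs), hd (lift_cycle v xs)} \<in> F"
proof -
  have "(last xs, hd xs) \<in> local_graph F n v" "xs \<noteq> []" using assms by (auto simp: cyc_def)
  note lh = this(2) local_graphD(4-6)[OF this(1)]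
  have "successively (\<lambda>p q. {p, q} \<in> F) (zigzag v xs)"
    using assms by (intro successively_zigzag[where n = n]) (simp add: cyc_def)
  then show "successively (\<lambda>p q. {p, q} \<in> F) (lift_cycle v xs)"
    "{last (lift_cycle v xs), hd (lift_cycle v xs)} \<in> F"
    using lh by (simp_all add: lift_cycle_def successively_Cons hd_zigzag last_zigzag)
qed

lemma local_cycle_imp_cycle:
  assumes "cyc (local_graph F n v) xs" "3 \<le> length xs" "surj v"
  shows "has_cycle F (2 * length xs)"
proof -
  have "length (lift_cycle v xs) = 2 * length xs"
    using assms(2) by (simp add: lift_cycle_def length_zigzag)
  moreover have "lift_cycle v xs \<noteq> []" by (simp add: lift_cycle_def)
  ultimately show ?thesis
    using has_cycleI[OF distinct_lift_cycle[OF assms] lift_cycle_edges(1)[OF assms(1)] _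
        lift_cycle_edges(2)[OF assms(1)]] by simp
qed

text \<open>The local cycles at \<open>i \<circ> w\<close> and \<open>i' \<circ> w\<close> lift to cycles that share exactly the edge
  from \<open>w\<close> to \<open>t \<circ> w\<close>; removing it joins them.\<close>

lemma glue_local_cycles:
  assumes A: "cyc (local_graph F n (i \<circ> w)) A" "3 \<le> length A" "hd A = t" "last A = i"
    and B: "cyc (local_graph F n (i' \<circ> w)) B" "3 \<le> length B" "hd B = t" "last B = i'"
    and o: "\<And>x. x \<in> set A \<Longrightarrow> ortho i' x"
    and ne: "last (butlast A) \<noteq> last (butlast B)"
    and w: "surj w"
  shows "has_cycle F (2 * (length A + length B - 1))"
proof -
  let ?v = "i \<circ> w" and ?v' = "i' \<circ> w"
  have iT: "i \<in> transps n" "i' \<in> transps n" "t \<in> transps n"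
    and it: "i \<circ> t = t \<circ> i" "i' \<circ> t = t \<circ> i'"
    using A B local_graphD[of i t F n ?v] local_graphD[of i' t F n ?v'] by (auto simp: cyc_def)
  have TA: "set A \<subseteq> transps n" and TB: "set B \<subseteq> transps n"
    using cyc_local_graph_transps A B by blast+
  have ABne: "A \<noteq> []" "B \<noteq> []" using A B by (auto simp: cyc_def)
  have dA: "distinct A" and dB: "distinct B" using A B by (auto simp: cyc_def)
  have iA: "i \<in> set A" using A(4) ABne by auto
  then have oi: "ortho i' i" using o by blast
  then have ii': "i \<circ> i' = i' \<circ> i" by (simp add: ortho_def)
  have surj_tr: "surj x" if "x \<in> transps n" for x using transps_involutory[OF that] by (metis surj_def)
  have v: "surj ?v" "surj ?v'" using comp_surj[OF w surj_tr] iT by auto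
  have w_eq: "i \<circ> ?v = w" "i' \<circ> ?v' = w" using transps_cancel iT by metis+
  have z_eq: "i \<circ> t \<circ> ?v = t \<circ> w" "i' \<circ> t \<circ> ?v' = t \<circ> w"
    using it w_eq by (metis comp_assoc)+
  have cancel: "f \<circ> ?v' = g \<circ> ?v \<longleftrightarrow> f \<circ> i' = g \<circ> i" for f g :: "nat \<Rightarrow> nat"
    using comp_right_cancel[OF w, of "f \<circ> i'" "g \<circ> i"] by (simp add: comp_assoc)
  have pairA: "a \<in> set A \<and> b \<in> set A \<and> ortho a b" if "(a, b) \<in> cyclic_pairs A" for a b
    using cyclic_pairs_set[OF ABne(1) that] local_graphD(3)[OF cyclic_pairs_cyc[OF A(1) that]] by simp
  have pairB: "a \<in> set B \<and> b \<in> set B \<and> ortho a b" if "(a, b) \<in> cyclic_pairs B" for a b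
    using cyclic_pairs_set[OF ABne(2) that] local_graphD(3)[OF cyclic_pairs_cyc[OF B(1) that]] by simp
  \<comment> \<open>A shared vertex is one or two steps from each base. Mixed cases contradict
    parity; one step from both gives \<open>w\<close>; two steps from both gives
    \<open>c \<circ> w\<close>, where \<open>c\<close> is adjacent to \<open>i\<close> on
    \<open>A\<close> and to \<open>i'\<close> on \<open>B\<close>, and \<open>ne\<close> leaves only
    \<open>c = t\<close>.\<close>
  have overlap: "p \<in> {w, t \<circ> w}" if pA: "p \<in> set (lift_cycle ?v A)" and pB: "p \<in> set (lift_cycle ?v' B)" for p
  proof -
    consider (11) x x' where "x \<in> set A" "x' \<in> set B" "p = x \<circ> ?v" "p = x' \<circ> ?v'"
      | (12) x a b where "x \<in> set A" "(a, b) \<in> cyclic_pairs B" "p = x \<circ> ?v" "p = a \<circ> b \<circ> ?v'"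
      | (21) x a b where "x \<in> set B" "(a, b) \<in> cyclic_pairs A" "p = x \<circ> ?v'" "p = a \<circ> b \<circ> ?v"
      | (22) a b a' b' where "(a, b) \<in> cyclic_pairs A" "(a', b') \<in> cyclic_pairs B"
          "p = a \<circ> b \<circ> ?v" "p = a' \<circ> b' \<circ> ?v'"
      using pA pB unfolding in_set_lift_cycle_iff by blast
    then show ?thesis
    proof cases
      case 11
      then have "x \<circ> i = x' \<circ> i'" using cancel by metis
      then have "x = i" using ortho_overlap_1[of i n x i' x'] iT TA TB 11 oi o by blast
      then show ?thesis using 11 w_eq by simp
    next
      case 12
      then have "x \<circ> i \<circ> i = a \<circ> b \<circ> i' \<circ> i" using cancel by metis
      then have "x = a \<circ> b \<circ> i' \<circ> i" using transps_comp_self[OF iT(1)] by (simp add: comp_assoc)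
      then show ?thesis using transps_comp_parity5[of i' n i a b x] iT TA TB 12 pairB[OF 12(2)] by blast
    next
      case 21
      then have "x \<circ> i' \<circ> i' = a \<circ> b \<circ> i \<circ> i'" using cancel by metis
      then have "x = a \<circ> b \<circ> i \<circ> i'" using transps_comp_self[OF iT(2)] by (simp add: comp_assoc)
      then show ?thesis using transps_comp_parity5[of i n i' a b x] iT TA TB 21 pairA[OF 21(2)] by blast
    next
      case 22
      note p = pairA[OF 22(1)] pairB[OF 22(2)]
      have eq: "a \<circ> b \<circ> i = a' \<circ> b' \<circ> i'" using 22 cancel by metis
      have "\<exists>c. {a, b} = {i, c} \<and> {a', b'} = {i', c}"
        by (rule ortho_overlap_2[OF _ _ _ _ _ _ oi _ _ _ _ eq]) (use p TA TB iT o in auto)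
      then obtain c where c: "{a, b} = {i, c}" "{a', b'} = {i', c}" by blast
      have "c = t \<or> c = last (butlast A)"
        using cyclic_pairs_last[OF 22(1) dA, of c] c(1) A by simp
      moreover have "c = t \<or> c = last (butlast B)"
        using cyclic_pairs_last[OF 22(2) dB, of c] c(2) B by simp
      ultimately have "c = t" using ne by auto
      then have "a \<circ> b = i \<circ> t" using c(1) it(1) by (auto simp: doubleton_eq_iff)
      then show ?thesis using 22(3) z_eq(1) by simp
    qed
  qed
  define zB where "zB = zigzag ?v' B"
  have LA: "lift_cycle ?v A = (t \<circ> w) # zigzag ?v A" using z_eq A by (simp add: lift_cycle_def)
  have LB: "lift_cycle ?v' B = (t \<circ> w) # zB" using z_eq B by (simp add: lift_cycle_def zB_def)
  have dLA: "distinct (lift_cycle ?v A)" using distinct_lift_cycle A v by blast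
  have dLB: "distinct (lift_cycle ?v' B)" using distinct_lift_cycle B v by blast
  have lastB: "last zB = w" "zB \<noteq> []" using ABne w_eq B by (simp_all add: zB_def last_zigzag)
  then have zB: "zB = butlast zB @ [w]" by (metis append_butlast_last_id)
  have lenB: "length (butlast zB) = 2 * length B - 2" by (simp add: zB_def length_zigzag)
  have bne: "butlast zB \<noteq> []" using lenB B(2) by (auto simp flip: length_0_conv)
  \<comment> \<open>Both lifts run from \<open>t \<circ> w\<close> to \<open>w\<close>. The second
    one, stripped of these ends and reversed, leads from \<open>w\<close> back to
    \<open>t \<circ> w\<close>.\<close>
  let ?C = "lift_cycle ?v A @ rev (butlast zB)"
  have "distinct (butlast zB @ [w])" using dLB LB zB by (metis distinct.simps(2))
  then have "w \<notin> set (butlast zB)" by simp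
  moreover have "t \<circ> w \<notin> set (butlast zB)" using dLB LB by (auto dest: in_set_butlastD)
  moreover have "set (butlast zB) \<subseteq> set (lift_cycle ?v' B)" using LB by (auto dest: in_set_butlastD)
  ultimately have "set (lift_cycle ?v A) \<inter> set (butlast zB) = {}" using overlap by blast
  moreover have "distinct (butlast zB)" using dLB LB by (simp add: distinct_butlast)
  ultimately have dC: "distinct ?C" using dLA by simp
  have sB: "successively (\<lambda>p q. {p, q} \<in> F) ((t \<circ> w) # butlast zB @ [w])"
    using lift_cycle_edges(1)[OF B(1)] LB zB by simp
  then have "{last (butlast zB), w} \<in> F" "{t \<circ> w, hd (butlast zB)} \<in> F"
    "successively (\<lambda>p q. {p, q} \<in> F) (butlast zB)"
    using bne by (simp_all add: successively_append_iff successively_Cons)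
  moreover have "last (lift_cycle ?v A) = w"
    using A ABne w_eq by (simp add: lift_cycle_def last_zigzag)
  ultimately have sC: "successively (\<lambda>p q. {p, q} \<in> F) ?C"
    using lift_cycle_edges(1)[OF A(1)] bne
    by (simp add: successively_append_iff successively_rev hd_rev insert_commute)
  have eC: "{last ?C, hd ?C} \<in> F"
    using bne \<open>{t \<circ> w, hd (butlast zB)} \<in> F\<close> LA by (simp add: last_rev insert_commute)
  have "length ?C = 2 * (length A + length B - 1)"
    using A(2) B(2) lenB by (simp add: lift_cycle_def length_zigzag)
  moreover have "?C \<noteq> []" using bne by simp
  ultimately show ?thesis using has_cycleI[OF dC sC _ eC] by simp
qed

section \<open>Counting edges through the local graphs\<close>

text \<open>Cauchy-Schwarz, read off from the sum of the squares
  \<open>(n * f x - s)\<^sup>2\<close>, with \<open>n\<close> the number of terms and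
  \<open>s\<close> their sum.\<close>

lemma sum_squared_le_card_mult:
  fixes f :: "'a \<Rightarrow> real"
  assumes "finite A"
  shows "(\<Sum>x\<in>A. f x)\<^sup>2 \<le> real (card A) * (\<Sum>x\<in>A. (f x)\<^sup>2)"
proof (cases "A = {}")
  case False
  define s where "s = (\<Sum>x\<in>A. f x)"
  define n where "n = real (card A)"
  have n: "n > 0" using False assms by (simp add: n_def card_gt_0_iff)
  have "0 \<le> (\<Sum>x\<in>A. (n * f x - s)\<^sup>2)" by (intro sum_nonneg) simp
  also have "\<dots> = (\<Sum>x\<in>A. n\<^sup>2 * (f x)\<^sup>2 - 2 * n * s * f x + s\<^sup>2)"
    by (intro sum.cong) (auto simp: power2_eq_square algebra_simps)
  also have "\<dots> = n\<^sup>2 * (\<Sum>x\<in>A. (f x)\<^sup>2) - 2 * n * s * s + n * s\<^sup>2"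
    by (simp add: sum.distrib sum_subtractf sum_distrib_left s_def n_def)
  also have "\<dots> = n * (n * (\<Sum>x\<in>A. (f x)\<^sup>2) - s\<^sup>2)"
    by (simp add: power2_eq_square algebra_simps)
  finally show ?thesis using n by (simp add: zero_le_mult_iff s_def n_def)
qed simp

definition nbrs :: "(nat \<Rightarrow> nat) set set \<Rightarrow> nat \<Rightarrow> (nat \<Rightarrow> nat) \<Rightarrow> (nat \<Rightarrow> nat) set" where
  "nbrs F n v = {t \<in> transps n. {v, t \<circ> v} \<in> F}"

lemma finite_CT_vertices: "finite (CT_vertices n)"
  by (simp add: CT_vertices_def finite_permutations)

lemma card_CT_vertices: "card (CT_vertices n) = fact n"
  by (simp add: CT_vertices_def card_permutations)

lemma surj_CT_vertices: "v \<in> CT_vertices n \<Longrightarrow> surj v"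
  by (simp add: CT_vertices_def permutes_surj)

lemma transps_comp_CT_vertices: "t \<in> transps n \<Longrightarrow> v \<in> CT_vertices n \<Longrightarrow> t \<circ> v \<in> CT_vertices n"
  by (auto simp: CT_vertices_def transps_def intro!: permutes_compose permutes_swap_id)

lemma CT_edges_eq: "CT_edges n = {{v, t \<circ> v} | v t. v \<in> CT_vertices n \<and> t \<in> transps n}"
  by (auto simp: CT_edges_def CT_vertices_def transps_def)

lemma finite_nbrs: "finite (nbrs F n v)"
  using finite_transps by (simp add: nbrs_def)

lemma finite_CT_edges: "finite (CT_edges n)"
proof -
  have "CT_edges n \<subseteq> (\<lambda>(v, t). {v, t \<circ> v}) ` (CT_vertices n \<times> transps n)"
    by (auto simp: CT_edges_eq)
  then show ?thesis by (rule finite_subset) (simp add: finite_CT_vertices finite_transps)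
qed

text \<open>An edge arises from both of its endpoints, each time with the same direction, because
  transpositions are involutions.\<close>

lemma sum_degrees:
  assumes F: "F \<subseteq> CT_edges n"
  shows "(\<Sum>v\<in>CT_vertices n. card (nbrs F n v)) = 2 * card F"
proof -
  define D where "D = (SIGMA v:CT_vertices n. nbrs F n v)"
  define \<phi> where "\<phi> = (\<lambda>(v :: nat \<Rightarrow> nat, t). {v, t \<circ> v})"
  have finF: "finite F" using F finite_CT_edges finite_subset by blast
  have finD: "finite D" unfolding D_def using finite_CT_vertices finite_nbrs by blast
  have fib: "card {p \<in> D. \<phi> p = e} = 2" if "e \<in> F" for e
  proof -
    have "e \<in> CT_edges n" using that F by auto
    then obtain x t where xt: "e = {x, t \<circ> x}" "x \<in> CT_vertices n" "t \<in> transps n"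
      by (auto simp: CT_edges_eq)
    have x: "surj x" using xt surj_CT_vertices by blast
    have tx: "t \<circ> (t \<circ> x) = x" using transps_cancel xt by blast
    have ne: "x \<noteq> t \<circ> x"
      using transps_moves[OF xt(3)] comp_right_cancel[OF x, of id t] by auto
    have D: "(v, s) \<in> D \<and> \<phi> (v, s) = e \<longleftrightarrow> (v, s) = (x, t) \<or> (v, s) = (t \<circ> x, t)" for v s
    proof
      assume vs: "(v, s) \<in> D \<and> \<phi> (v, s) = e"
      then have s: "s \<in> transps n" and "{v, s \<circ> v} = {x, t \<circ> x}"
        by (auto simp: D_def nbrs_def \<phi>_def xt)
      then consider "v = x" "s \<circ> v = t \<circ> x" | "v = t \<circ> x" "s \<circ> v = x" by (auto simp: doubleton_eq_iff)
      then show "(v, s) = (x, t) \<or> (v, s) = (t \<circ> x, t)"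
      proof cases
        case 1
        then show ?thesis using comp_right_cancel[OF x] by auto
      next
        case 2
        then have "s \<circ> (s \<circ> (t \<circ> x)) = s \<circ> x" by simp
        then have "t \<circ> x = s \<circ> x" using transps_cancel[OF s] by metis
        then show ?thesis using comp_right_cancel[OF x] 2 by metis
      qed
    next
      assume "(v, s) = (x, t) \<or> (v, s) = (t \<circ> x, t)"
      then show "(v, s) \<in> D \<and> \<phi> (v, s) = e"
        using that xt tx transps_comp_CT_vertices by (auto simp: D_def nbrs_def \<phi>_def insert_commute)
    qed
    then have "{p \<in> D. \<phi> p = e} = {(x, t), (t \<circ> x, t)}" by auto
    then show ?thesis using ne by simp
  qed
  have "\<phi> ` D \<subseteq> F" by (auto simp: D_def nbrs_def \<phi>_def)
  then have "card D = (\<Sum>e\<in>F. card {p \<in> D. \<phi> p = e})"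
    using sum.group[OF finD finF, of \<phi> "\<lambda>_. 1::nat"] by simp
  also have "\<dots> = 2 * card F" using fib by simp
  finally show ?thesis
    unfolding D_def using finite_CT_vertices finite_nbrs by (simp add: card_SigmaI)
qed

lemma e_CT_eq: "2 * e_CT n = fact n * (n choose 2)"
proof -
  have "nbrs (CT_edges n) n v = transps n" if "v \<in> CT_vertices n" for v
    using that by (auto simp: nbrs_def CT_edges_eq)
  then show ?thesis
    using sum_degrees[of "CT_edges n" n] by (simp add: e_CT_def card_transps card_CT_vertices)
qed

lemma ortho_pairs_ge:
  "real (card (nbrs F n w))^2 - 2 * real n * real (card (nbrs F n w))
    \<le> real (card {(i, t). i \<in> nbrs F n w \<and> t \<in> nbrs F n w \<and> ortho i t})"
proof -
  let ?N = "nbrs F n w"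
  let ?P = "{(i, t). i \<in> ?N \<and> t \<in> ?N \<and> ortho i t}"
  let ?Q = "SIGMA i:?N. {t \<in> transps n. \<not> ortho i t}"
  have fin: "finite ?P" "finite ?Q"
    using finite_nbrs finite_transps by (auto intro: finite_subset[of _ "?N \<times> ?N"])
  have "card ?N * card ?N = card (?N \<times> ?N)" by (simp add: card_cartesian_product)
  also have "\<dots> \<le> card (?P \<union> ?Q)" using fin by (intro card_mono) (auto simp: nbrs_def)
  also have "\<dots> \<le> card ?P + card ?Q" by (rule card_Un_le)
  also have "card ?Q = (\<Sum>i\<in>?N. card {t \<in> transps n. \<not> ortho i t})"
    using finite_nbrs finite_transps by (intro card_SigmaI) auto
  also have "\<dots> \<le> (\<Sum>i\<in>?N. 2 * n)" by (intro sum_mono card_not_ortho) (simp add: nbrs_def)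
  finally have "real (card ?N * card ?N) \<le> real (card ?P + 2 * n * card ?N)"
    unfolding of_nat_le_iff by (simp add: mult.commute)
  then show ?thesis by (simp add: power2_eq_square)
qed

text \<open>A commuting pair \<open>i\<close>, \<open>t\<close> of directions at \<open>w\<close> is
  a path with middle vertex \<open>w\<close>, hence a local edge at
  \<open>i \<circ> t \<circ> w\<close>. Passing from \<open>(w, i, t)\<close> to that base is its
  own inverse.\<close>

lemma sum_local_graph_ge:
  "(\<Sum>w\<in>CT_vertices n. card {(i, t). i \<in> nbrs F n w \<and> t \<in> nbrs F n w \<and> ortho i t})
    \<le> (\<Sum>v\<in>CT_vertices n. card (local_graph F n v))"
proof -
  define P where "P = (\<lambda>w. {(i, t). i \<in> nbrs F n w \<and> t \<in> nbrs F n w \<and> ortho i t})"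
  define h where "h = (\<lambda>(w :: nat \<Rightarrow> nat, i, t). (i \<circ> t \<circ> w, i :: nat \<Rightarrow> nat, t :: nat \<Rightarrow> nat))"
  have finP: "finite (P w)" for w
    using finite_nbrs by (auto simp: P_def intro: finite_subset[of _ "nbrs F n w \<times> nbrs F n w"])
  have undo: "i \<circ> (i \<circ> t \<circ> w) = t \<circ> w" "t \<circ> (i \<circ> t \<circ> w) = i \<circ> w" "i \<circ> t \<circ> (i \<circ> t \<circ> w) = w"
    if "i \<in> transps n" "t \<in> transps n" "ortho i t" for i t w
  proof -
    have it: "i \<circ> t = t \<circ> i" using that by (simp add: ortho_def)
    show a: "i \<circ> (i \<circ> t \<circ> w) = t \<circ> w" using transps_cancel[OF that(1)] by (simp add: comp_assoc)
    show b: "t \<circ> (i \<circ> t \<circ> w) = i \<circ> w" using transps_cancel[OF that(2)] unfolding it by (simp add: comp_assoc)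
    have "i \<circ> t \<circ> (i \<circ> t \<circ> w) = i \<circ> (t \<circ> (i \<circ> t \<circ> w))" by (simp only: comp_assoc)
    then show "i \<circ> t \<circ> (i \<circ> t \<circ> w) = w" unfolding b using transps_cancel[OF that(1)] by simp
  qed
  have inj: "inj_on h (SIGMA w:CT_vertices n. P w)"
  proof (rule inj_on_inverseI[where g = h])
    fix p assume "p \<in> (SIGMA w:CT_vertices n. P w)"
    then show "h (h p) = p"
      using undo(3) by (auto simp: h_def P_def nbrs_def)
  qed
  have sub: "h ` (SIGMA w:CT_vertices n. P w) \<subseteq> (SIGMA v:CT_vertices n. local_graph F n v)"
  proof
    fix q assume "q \<in> h ` (SIGMA w:CT_vertices n. P w)"
    then obtain w i t where q: "q = (i \<circ> t \<circ> w, i, t)" and w: "w \<in> CT_vertices n" and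
      it: "i \<in> nbrs F n w" "t \<in> nbrs F n w" "ortho i t" by (auto simp: h_def P_def)
    have T: "i \<in> transps n" "t \<in> transps n" using it by (auto simp: nbrs_def)
    have "i \<circ> t \<circ> w \<in> CT_vertices n"
      using transps_comp_CT_vertices T w by (simp add: comp_assoc)
    moreover have "(i, t) \<in> local_graph F n (i \<circ> t \<circ> w)"
      using it T unfolding local_graph_def mem_Collect_eq case_prod_conv undo[OF T it(3)]
      by (simp add: nbrs_def insert_commute)
    ultimately show "q \<in> (SIGMA v:CT_vertices n. local_graph F n v)" using q by simp
  qed
  have "card (SIGMA w:CT_vertices n. P w) \<le> card (SIGMA v:CT_vertices n. local_graph F n v)"
    using inj sub finite_CT_vertices finite_local_graph by (intro card_inj_on_le[of h]) auto
  then have "(\<Sum>w\<in>CT_vertices n. card (P w)) \<le> (\<Sum>v\<in>CT_vertices n. card (local_graph F n v))"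
    using finite_CT_vertices finite_local_graph finP by (simp add: card_SigmaI)
  then show ?thesis unfolding P_def .
qed

lemma sum_local_graph_ge_degrees:
  "(\<Sum>v\<in>CT_vertices n. real (card (nbrs F n v))^2 - 2 * real n * real (card (nbrs F n v)))
    \<le> real (\<Sum>v\<in>CT_vertices n. card (local_graph F n v))"
proof -
  have "(\<Sum>v\<in>CT_vertices n. real (card (nbrs F n v))^2 - 2 * real n * real (card (nbrs F n v)))
      \<le> (\<Sum>w\<in>CT_vertices n. real (card {(i, t). i \<in> nbrs F n w \<and> t \<in> nbrs F n w \<and> ortho i t}))"
    by (intro sum_mono ortho_pairs_ge)
  also have "\<dots> \<le> real (\<Sum>v\<in>CT_vertices n. card (local_graph F n v))"
    unfolding of_nat_sum[symmetric] of_nat_le_iff by (rule sum_local_graph_ge)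
  finally show ?thesis .
qed

lemma sum_local_graph_ge_edges:
  assumes "F \<subseteq> CT_edges n"
  shows "(2 * real (card F))^2 / fact n - 4 * real n * real (card F)
    \<le> real (\<Sum>v\<in>CT_vertices n. card (local_graph F n v))"
proof -
  let ?d = "\<lambda>v. real (card (nbrs F n v))"
  have S: "(\<Sum>v\<in>CT_vertices n. ?d v) = 2 * real (card F)"
    using sum_degrees[OF assms] by (metis of_nat_mult of_nat_numeral of_nat_sum)
  have "(2 * real (card F))^2 \<le> fact n * (\<Sum>v\<in>CT_vertices n. (?d v)^2)"
    using sum_squared_le_card_mult[OF finite_CT_vertices, of ?d n] S by (simp add: card_CT_vertices)
  then have "(2 * real (card F))^2 / fact n \<le> (\<Sum>v\<in>CT_vertices n. (?d v)^2)"
    by (simp add: divide_le_eq mult.commute)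
  moreover have "(\<Sum>v\<in>CT_vertices n. (?d v)^2 - 2 * real n * ?d v)
      = (\<Sum>v\<in>CT_vertices n. (?d v)^2) - 2 * real n * (2 * real (card F))"
    by (simp add: sum_subtractf S flip: sum_distrib_left)
  ultimately show ?thesis using sum_local_graph_ge_degrees[of F n] by linarith
qed

section \<open>From local counts to the extremal number\<close>

lemma ex_CT_cycle_attained:
  assumes "m \<ge> 1"
  obtains F where "F \<subseteq> CT_edges n" "\<not> has_cycle F m" "card F = ex_CT_cycle n m"
proof -
  let ?S = "{card F | F. F \<subseteq> CT_edges n \<and> \<not> has_cycle F m}"
  have "\<not> has_cycle {} m" using assms unfolding has_cycle_def by (metis empty_iff less_le_trans zero_less_one)
  then have "?S \<noteq> {}" by blast
  moreover have "?S \<subseteq> card ` Pow (CT_edges n)" by auto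
  then have "finite ?S" by (rule finite_subset) (simp add: finite_CT_edges)
  ultimately have "Max ?S \<in> ?S" by (intro Max_in)
  then show ?thesis using that unfolding ex_CT_cycle_def by auto
qed

text \<open>For the average degree \<open>D\<close> the hypothesis says
  \<open>D\<^sup>2 \<le> r * n * D + c * (n powr \<beta>)\<^sup>2\<close>, and
  \<open>\<beta> \<ge> 1\<close> lets \<open>n powr \<beta>\<close> dominate \<open>n\<close>, so
  \<open>D \<le> (c + r + 1) * n powr \<beta>\<close>. The exponent drops by 2 and a factor 3
  appears on division by the degree \<open>n choose 2\<close>, since
  \<open>n ^ 2 \<le> 3 * (n choose 2)\<close> from \<open>n = 3\<close> on.\<close>

lemma edge_bound_from_quadratic:
  fixes \<beta> r c :: real
  assumes n: "n \<ge> 3" and \<beta>: "\<beta> \<ge> 1" and rc: "r \<ge> 0" "c \<ge> 0"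
    and quad: "(2 * real f)^2 / fact n \<le> r * real n * (2 * real f) + c * fact n * (real n powr \<beta>)^2"
  shows "real f \<le> 3 * (c + r + 1) * real n powr (\<beta> - 2) * real (e_CT n)"
proof -
  define a where "a = real n powr \<beta>"
  define D where "D = 2 * real f / fact n"
  have a: "a \<ge> real n" "a > 0" using n \<beta> powr_mono[of 1 \<beta> "real n"] by (auto simp: a_def)
  have D: "D \<ge> 0" "2 * real f = D * fact n" by (auto simp: D_def)
  have "D^2 * fact n \<le> (r * real n * D + c * a^2) * fact n"
    using quad unfolding D(2) a_def[symmetric] by (simp add: power2_eq_square algebra_simps)
  then have "D^2 \<le> r * real n * D + c * a^2" by simp
  also have "\<dots> \<le> r * a * D + c * a^2" using a rc D by (intro add_right_mono mult_right_mono mult_left_mono) auto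
  finally have q: "D^2 \<le> r * a * D + c * a^2" .
  have "D \<le> (c + r + 1) * a"
  proof (rule ccontr)
    assume "\<not> ?thesis"
    then have big: "(c + r + 1) * a < D" by simp
    have pos: "0 < (c + 1) * a" using a rc by simp
    have "1 * a \<le> (c + r + 1) * a" using a rc by (intro mult_right_mono) auto
    then have "a \<le> D" using big by simp
    have "c * a^2 < (c + 1) * a * a" using a by (simp add: power2_eq_square algebra_simps)
    also have "\<dots> \<le> (c + 1) * a * D" using \<open>a \<le> D\<close> pos by (intro mult_left_mono) auto
    also have "\<dots> \<le> (D - r * a) * D" using big D by (intro mult_right_mono) (auto simp: algebra_simps)
    finally show False using q by (simp add: power2_eq_square algebra_simps)
  qed
  then have "2 * real f \<le> (c + r + 1) * a * fact n" unfolding D(2) by (intro mult_right_mono) auto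
  moreover have "real n powr (\<beta> - 2) * real n ^ 2 = a"
    using n by (simp add: a_def powr_diff)
  moreover have "real n ^ 2 \<le> 3 * real (n choose 2)"
  proof -
    have "real (n choose 2) = real n * (real n - 1) / 2"
      using n by (simp add: choose_two real_of_nat_div of_nat_diff)
    moreover have "real n * (real n - 3) \<ge> 0" using n by simp
    ultimately show ?thesis by (simp add: power2_eq_square algebra_simps)
  qed
  ultimately have "2 * real f \<le> (c + r + 1) * (real n powr (\<beta> - 2) * real n ^ 2) * fact n" by simp
  also have "\<dots> \<le> (c + r + 1) * (real n powr (\<beta> - 2) * (3 * real (n choose 2))) * fact n"
    using \<open>real n ^ 2 \<le> 3 * real (n choose 2)\<close> rc by (intro mult_right_mono mult_left_mono) auto
  also have "\<dots> = 3 * (c + r + 1) * real n powr (\<beta> - 2) * (2 * real (e_CT n))"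
    using arg_cong[OF e_CT_eq[of n], of real] by simp
  finally show ?thesis by simp
qed

section \<open>Cycles of length divisible by four\<close>

lemma irrefl_local_graph: "irrefl (local_graph F n v)"
  by (auto simp: irrefl_def local_graph_def ortho_def)

lemma powr_transps_le:
  assumes "n \<ge> 3" "0 \<le> \<beta>" "\<beta> \<le> \<gamma>"
  shows "real (card (transps n)) powr \<beta> \<le> (real n powr \<gamma>)\<^sup>2"
proof -
  have "n choose 2 \<le> n ^ 2" using assms(1) by (intro binomial_le_pow) simp
  then have "real (card (transps n)) \<le> real n ^ 2" by (metis card_transps of_nat_le_iff of_nat_power)
  then have "real (card (transps n)) powr \<beta> \<le> (real n ^ 2) powr \<beta>"
    using assms by (intro powr_mono2) auto
  also have "\<dots> \<le> (real n ^ 2) powr \<gamma>" using assms by (intro powr_mono) (auto simp: one_le_power)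
  also have "\<dots> = (real n powr \<gamma>)\<^sup>2" using assms by (simp add: power2_eq_square powr_mult)
  finally show ?thesis .
qed

lemma local_graph_no_cycle_card_le:
  assumes "k \<ge> 2"
  obtains c :: real where "c > 0" "\<And>n R \<gamma>. n \<ge> 3 \<Longrightarrow> R \<subseteq> transps n \<times> transps n \<Longrightarrow> sym R \<Longrightarrow>
    (\<nexists>xs. cyc R xs \<and> length xs = 2 * k) \<Longrightarrow> 1 + 1 / real k \<le> \<gamma> \<Longrightarrow> real (card R) \<le> c * (real n powr \<gamma>)\<^sup>2"
proof -
  have "k \<ge> 1" using assms by simp
  then obtain c :: real where c: "c > 0" "\<And>(W :: (nat \<Rightarrow> nat) set) R. finite W \<Longrightarrow> R \<subseteq> W \<times> W \<Longrightarrow> sym R \<Longrightarrow>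
    (\<nexists>xs. cyc R xs \<and> length xs = 2 * k) \<Longrightarrow> real (card R) \<le> c * real (card W) powr (1 + 1 / real k)"
    using even_cycle_bound[where 'a = "nat \<Rightarrow> nat"] by metis
  show ?thesis
  proof (rule that[OF c(1)])
    fix n R and \<gamma> :: real
    assume n: "n \<ge> 3" and R: "R \<subseteq> transps n \<times> transps n" "sym R"
      "\<nexists>xs. cyc R xs \<and> length xs = 2 * k" and \<gamma>: "1 + 1 / real k \<le> \<gamma>"
    have "real (card R) \<le> c * real (card (transps n)) powr (1 + 1 / real k)"
      by (rule c(2)[OF finite_transps R])
    also have "\<dots> \<le> c * (real n powr \<gamma>)\<^sup>2"
      using c(1) n \<gamma> by (intro mult_left_mono powr_transps_le) auto
    finally show "real (card R) \<le> c * (real n powr \<gamma>)\<^sup>2" .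
  qed
qed

lemma ex_CT_cycle_even:
  fixes l :: nat
  assumes "l \<ge> 4" "even l"
  shows "\<exists>C::real. C > 0 \<and> (\<forall>n::nat. n \<ge> 3 \<longrightarrow>
          real (ex_CT_cycle n (2 * l)) \<le> C * real n powr (-1 + 2 / real l) * real (e_CT n))"
proof -
  obtain k where l: "l = 2 * k" using assms(2) by (elim evenE)
  have k: "k \<ge> 2" using assms l by simp
  obtain c :: real where c: "c > 0" "\<And>n R \<gamma>. n \<ge> 3 \<Longrightarrow> R \<subseteq> transps n \<times> transps n \<Longrightarrow> sym R \<Longrightarrow>
    (\<nexists>xs. cyc R xs \<and> length xs = 2 * k) \<Longrightarrow> 1 + 1 / real k \<le> \<gamma> \<Longrightarrow> real (card R) \<le> c * (real n powr \<gamma>)\<^sup>2"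
    by (rule local_graph_no_cycle_card_le[OF k]) blast
  define \<gamma> where "\<gamma> = 1 + 1 / real k"
  have "real (ex_CT_cycle n (2 * l)) \<le> 3 * (c + 2 + 1) * real n powr (-1 + 2 / real l) * real (e_CT n)"
    if n: "n \<ge> 3" for n
  proof -
    obtain F where F: "F \<subseteq> CT_edges n" "\<not> has_cycle F (2 * l)" "card F = ex_CT_cycle n (2 * l)"
      using ex_CT_cycle_attained[of "2 * l" n] assms by auto
    have "real (card (local_graph F n v)) \<le> c * (real n powr \<gamma>)\<^sup>2" if v: "v \<in> CT_vertices n" for v
    proof (rule c(2)[OF n local_graph_subset sym_local_graph])
      show "\<nexists>xs. cyc (local_graph F n v) xs \<and> length xs = 2 * k"
        using local_cycle_imp_cycle[of F n v] surj_CT_vertices[OF v] F(2) k l by fastforce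
    qed (simp add: \<gamma>_def)
    then have "(\<Sum>v\<in>CT_vertices n. real (card (local_graph F n v)))
        \<le> real (card (CT_vertices n)) * (c * (real n powr \<gamma>)\<^sup>2)"
      by (intro sum_bounded_above) auto
    \<comment> \<open>The loss \<open>4 * n * card F\<close> is \<open>2 * n\<close> times the
      degree sum, which accounts for \<open>r = 2\<close>.\<close>
    then have "(2 * real (card F))^2 / fact n
        \<le> 2 * real n * (2 * real (card F)) + c * fact n * (real n powr \<gamma>)\<^sup>2"
      using sum_local_graph_ge_edges[OF F(1)] by (simp add: card_CT_vertices algebra_simps)
    then have "real (card F) \<le> 3 * (c + 2 + 1) * real n powr (\<gamma> - 2) * real (e_CT n)"
      using c(1) by (intro edge_bound_from_quadratic n) (auto simp: \<gamma>_def)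
    moreover have "\<gamma> - 2 = -1 + 2 / real l" using k by (simp add: \<gamma>_def l)
    ultimately show ?thesis using F(3) by simp
  qed
  then show ?thesis using c(1) by (intro exI[of _ "3 * (c + 2 + 1)"]) auto
qed

section \<open>Gluing two local cycles\<close>

lemma cyc_rotate: "cyc R (us @ vs) \<Longrightarrow> cyc R (vs @ us)"
  by (cases "us = []"; cases "vs = []") (auto simp: cyc_def successively_append_iff)

lemma cyc_rev:
  assumes "sym R" "cyc R xs"
  shows "cyc R (rev xs)"
proof -
  have "successively (\<lambda>x y. (y, x) \<in> R) xs"
  proof (rule successively_mono)
    show "successively (\<lambda>x y. (x, y) \<in> R) xs" using assms(2) by (simp add: cyc_def)
  qed (rule symD[OF assms(1)])
  moreover have "(hd xs, last xs) \<in> R" using assms by (auto simp: cyc_def elim: symE)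
  ultimately show ?thesis
    using assms(2) by (simp add: cyc_def hd_rev last_rev)
qed

text \<open>If every \<open>q\<close>-cycle leaves each vertex along an edge that is determined by the one it arrives
  on, then deleting, for each matched pair of edges going down from a vertex, the one with the
  smaller endpoint destroys every \<open>q\<close>-cycle at its highest vertex.\<close>

lemma forced_cycles_half:
  fixes R :: "('a \<times> 'a) set" and h :: "'a \<Rightarrow> nat"
  assumes fin: "finite R" and sym: "sym R" and R: "R \<subseteq> W \<times> W" and irr: "irrefl R"
    and inj: "inj_on h W" and q: "q \<ge> 3"
    and forced: "\<And>B. cyc R B \<Longrightarrow> length B = q \<Longrightarrow> last (butlast B) = \<kappa> (last B) (hd B)"
  shows "\<exists>K\<subseteq>R. sym K \<and> (\<nexists>B. cyc K B \<and> length B = q) \<and> card R \<le> 4 * card K"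
proof -
  define H where "H = {(i, t) \<in> R. h t < h i}"
  \<comment> \<open>Only pairs that \<open>\<kappa>\<close> matches in both directions count; this
    makes the matching injective, so moving to the higher partner shows that at most half of
    \<open>H\<close> is deleted.\<close>
  define D where "D = {(i, t) \<in> H. (i, \<kappa> i t) \<in> H \<and> \<kappa> i (\<kappa> i t) = t \<and> h t < h (\<kappa> i t)}"
  define K where "K = (H - D) \<union> (H - D)\<inverse>"
  have finH: "finite H" and DH: "D \<subseteq> H" and HR: "H \<subseteq> R"
    using fin by (auto simp: H_def D_def intro: finite_subset[of _ R])
  have "R \<subseteq> H \<union> H\<inverse>"
  proof
    fix p assume "p \<in> R"
    moreover obtain x y where p: "p = (x, y)" by (cases p)
    ultimately have xy: "(x, y) \<in> R" "(y, x) \<in> R" "x \<in> W" "y \<in> W" using sym R by (auto elim: symE)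
    then have "x \<noteq> y" using irr by (auto simp: irrefl_def)
    then have "h x \<noteq> h y" using inj xy by (auto simp: inj_on_def)
    then have "h x < h y \<or> h y < h x" by auto
    then show "p \<in> H \<union> H\<inverse>" using xy p by (auto simp: H_def)
  qed
  then have "card R \<le> card (H \<union> H\<inverse>)" using finH by (intro card_mono) auto
  also have "\<dots> \<le> card H + card (H\<inverse>)" by (rule card_Un_le)
  finally have RH: "card R \<le> 2 * card H" by (simp add: card_inverse)
  have "card D \<le> card (H - D)"
  proof (rule card_inj_on_le[where f = "\<lambda>(i, t). (i, \<kappa> i t)"])
    show "inj_on (\<lambda>(i, t). (i, \<kappa> i t)) D"
      by (rule inj_on_inverseI[where g = "\<lambda>(i, t). (i, \<kappa> i t)"]) (auto simp: D_def)
    show "(\<lambda>(i, t). (i, \<kappa> i t)) ` D \<subseteq> H - D" by (auto simp: D_def)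
    show "finite (H - D)" using finH by simp
  qed
  moreover have "card (H - D) + card D = card H"
    using card_Diff_subset[OF finite_subset[OF DH finH] DH] card_mono[OF finH DH] by simp
  moreover have "card (H - D) \<le> card K" using finH by (auto simp: K_def intro!: card_mono)
  ultimately have "card R \<le> 4 * card K" using RH by linarith
  moreover have "sym K" by (auto simp: sym_def K_def)
  moreover have KR: "K \<subseteq> R" using HR sym by (auto simp: K_def elim: symE)
  moreover have "\<nexists>B. cyc K B \<and> length B = q"
  proof
    assume "\<exists>B. cyc K B \<and> length B = q"
    then obtain B where B: "cyc K B" "length B = q" by blast
    have "B \<noteq> []" using B by (simp add: cyc_def)
    have "Max (h ` set B) \<in> h ` set B" using \<open>B \<noteq> []\<close> by (intro Max_in) auto
    then obtain x where "x \<in> set B" "h x = Max (h ` set B)" by auto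
    then have x: "x \<in> set B" "\<And>y. y \<in> set B \<Longrightarrow> h y \<le> h x" by auto
    obtain us vs where "B = us @ x # vs" using x(1) by (meson split_list)
    define ys where "ys = vs @ us"
    have cB: "cyc K (ys @ [x])"
      using cyc_rotate[of K "us @ [x]" vs] B(1) \<open>B = us @ x # vs\<close> by (simp add: ys_def)
    have len: "length ys = q - 1" and sB: "set (ys @ [x]) = set B" using B \<open>B = us @ x # vs\<close> by (auto simp: ys_def)
    have ys: "ys \<noteq> []" using len q by auto
    define t where "t = hd ys"
    define c where "c = last ys"
    have d: "distinct (ys @ [x])" using cB by (simp add: cyc_def)
    have tc: "t \<noteq> c"
    proof -
      have "t = ys ! 0" "c = ys ! (q - 2)" using ys len by (simp_all add: t_def c_def hd_conv_nth last_conv_nth numeral_2_eq_2)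
      then show ?thesis using d len q by (simp add: nth_eq_iff_index_eq)
    qed
    have tcx: "t \<in> set B" "c \<in> set B" "t \<noteq> x" "c \<noteq> x" using ys d sB unfolding t_def c_def by (auto dest: hd_in_set last_in_set)
    have BW: "a \<in> W" if "a \<in> set B" for a
      using cyc_subset[OF B(1), of W] KR R that by blast
    have ht: "h t < h x" "h c < h x" "h t \<noteq> h c"
      using x tcx tc BW inj unfolding inj_on_def by (metis le_neq_implies_less)+
    have "(x, t) \<in> K" "(c, x) \<in> K"
      using cB ys by (auto simp: cyc_def t_def c_def successively_append_iff)
    then have HD: "(x, t) \<in> H - D" "(x, c) \<in> H - D"
      using ht by (auto simp: K_def H_def)
    have cR: "cyc R (ys @ [x])" using cyc_mono[OF KR cB] .
    \<comment> \<open>Traversing the cycle backwards through its highest vertex \<open>x\<close>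
      gives the matching in the other direction, so one of the two edges at \<open>x\<close> lies in
      \<open>D\<close>.\<close>
    have "cyc R (rev ys @ [x])"
      using cyc_rotate[of R "[x]" "rev ys"] cyc_rev[OF sym cR] by simp
    then have "last (rev ys) = \<kappa> x (hd (rev ys))"
      using forced[of "rev ys @ [x]"] len q ys by simp
    then have 1: "\<kappa> x c = t" using ys by (simp add: last_rev hd_rev t_def c_def)
    have 2: "\<kappa> x t = c" using forced[OF cR] len q ys by (simp add: t_def c_def)
    show False using HD 1 2 ht by (auto simp: D_def)
  qed
  ultimately show ?thesis by blast
qed

text \<open>The lift of \<open>A\<close> passes through the edge from \<open>w\<close> to
  \<open>t \<circ> w\<close>. Its base is recovered from \<open>last A\<close> rather than
  prescribed, so the notion refers to that edge alone.\<close>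

definition local_four_cycle :: "(nat \<Rightarrow> nat) set set \<Rightarrow> nat \<Rightarrow> (nat \<Rightarrow> nat) \<Rightarrow> (nat \<Rightarrow> nat) \<Rightarrow> (nat \<Rightarrow> nat) list \<Rightarrow> bool" where
  "local_four_cycle F n w t A \<longleftrightarrow> cyc (local_graph F n (last A \<circ> w)) A \<and> length A = 4 \<and> hd A = t"

text \<open>One cycle per \<open>(w, t)\<close>, chosen independently of the longer cycle to be
  glued to it. This makes the forced predecessor of the last entry a function of the last and first
  entries.\<close>

definition witness :: "(nat \<Rightarrow> nat) set set \<Rightarrow> nat \<Rightarrow> (nat \<Rightarrow> nat) \<Rightarrow> (nat \<Rightarrow> nat) \<Rightarrow> (nat \<Rightarrow> nat) list" where
  "witness F n w t = (SOME A. local_four_cycle F n w t A)"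

text \<open>Existence is demanded because the choice in \<open>witness\<close> is otherwise
  arbitrary; the second condition is the one that \<open>glue_local_cycles\<close> puts on
  \<open>i'\<close>.\<close>

definition good :: "(nat \<Rightarrow> nat) set set \<Rightarrow> nat \<Rightarrow> (nat \<Rightarrow> nat) \<Rightarrow> (nat \<Rightarrow> nat) \<Rightarrow> (nat \<Rightarrow> nat) \<Rightarrow> bool" where
  "good F n w t i \<longleftrightarrow> (\<exists>A. local_four_cycle F n w t A) \<and> (\<forall>x\<in>set (witness F n w t). ortho i x)"

lemma local_four_cycle_witness:
  "local_four_cycle F n w t A \<Longrightarrow> local_four_cycle F n w t (witness F n w t)"
  unfolding witness_def by (rule someI)

text \<open>Goodness depends on the orientation of a local edge; asking for both orientations gives
  a symmetric relation, as \<open>forced_cycles_half\<close> requires.\<close>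

definition good_graph :: "(nat \<Rightarrow> nat) set set \<Rightarrow> nat \<Rightarrow> (nat \<Rightarrow> nat) \<Rightarrow> ((nat \<Rightarrow> nat) \<times> (nat \<Rightarrow> nat)) set" where
  "good_graph F n v = {(t, i) \<in> local_graph F n v. good F n (i \<circ> v) t i \<and> good F n (t \<circ> v) i t}"

lemma good_graph_subset: "good_graph F n v \<subseteq> local_graph F n v"
  by (auto simp: good_graph_def)

lemma sym_good_graph: "sym (good_graph F n v)"
  using sym_local_graph[of F n v] by (auto simp: sym_def good_graph_def)

text \<open>Otherwise the witness and \<open>B\<close> can be glued, to a cycle of length
  \<open>2 * (4 + q - 1) = 2 * (q + 3)\<close>.\<close>

lemma good_graph_forced:
  assumes no_cycle: "\<not> has_cycle F (2 * (q + 3))" and v: "v \<in> CT_vertices n"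
    and B: "cyc (good_graph F n v) B" "length B = q" and q: "q \<ge> 3"
  shows "last (butlast B) = last (butlast (witness F n (last B \<circ> v) (hd B)))"
proof (rule ccontr)
  define i where "i = last B"
  define t where "t = hd B"
  define w where "w = i \<circ> v"
  define A where "A = witness F n w t"
  assume "\<not> ?thesis"
  then have ne: "last (butlast A) \<noteq> last (butlast B)" by (simp add: A_def w_def t_def i_def)
  have "(i, t) \<in> good_graph F n v" using B by (simp add: cyc_def i_def t_def)
  then have loc: "(i, t) \<in> local_graph F n v" and "good F n w t i"
    by (auto simp: good_graph_def w_def)
  then have A: "local_four_cycle F n w t A" and o: "\<And>x. x \<in> set A \<Longrightarrow> ortho i x"
    using local_four_cycle_witness by (auto simp: good_def A_def)
  have iT: "i \<in> transps n" using local_graphD[OF loc] by simp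
  then have w: "surj w" "i \<circ> w = v"
    unfolding w_def using surj_CT_vertices[OF transps_comp_CT_vertices[OF iT v]] transps_cancel[OF iT]
    by simp_all
  have "has_cycle F (2 * (length A + length B - 1))"
  proof (rule glue_local_cycles)
    show "cyc (local_graph F n (last A \<circ> w)) A" "3 \<le> length A" "hd A = t"
      using A by (auto simp: local_four_cycle_def)
    show "cyc (local_graph F n (i \<circ> w)) B" using cyc_mono[OF good_graph_subset B(1)] w by simp
  qed (use B q o ne w in \<open>simp_all add: i_def t_def\<close>)
  moreover have "length A + length B - 1 = q + 3" using A B by (simp add: local_four_cycle_def)
  ultimately show False using no_cycle by simp
qed

text \<open>With \<open>w = i \<circ> v\<close> the triples are counted over the
  \<open>2 * card F\<close> pairs \<open>(w, t)\<close>. For each pair, every one of the four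
  entries of the witness rules out at most \<open>2 * n\<close> choices of \<open>i\<close>.\<close>

lemma sum_not_ortho_witness_le:
  assumes F: "F \<subseteq> CT_edges n"
  shows "(\<Sum>v\<in>CT_vertices n. card {(t, i) \<in> local_graph F n v.
      (\<exists>A. local_four_cycle F n (i \<circ> v) t A) \<and> (\<exists>x\<in>set (witness F n (i \<circ> v) t). \<not> ortho i x)})
    \<le> 16 * n * card F"
proof -
  define P where "P = (\<lambda>v. {(t, i) \<in> local_graph F n v.
      (\<exists>A. local_four_cycle F n (i \<circ> v) t A) \<and> (\<exists>x\<in>set (witness F n (i \<circ> v) t). \<not> ortho i x)})"
  define Q where "Q = (\<lambda>w t. {i \<in> transps n. (\<exists>A. local_four_cycle F n w t A) \<and> (\<exists>x\<in>set (witness F n w t). \<not> ortho i x)})"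
  have finP: "finite (P v)" for v
    using finite_local_graph[of F n v] by (auto simp: P_def intro: finite_subset)
  have finQ: "finite (Q w t)" for w t using finite_transps by (simp add: Q_def)
  have cQ: "card (Q w t) \<le> 8 * n" for w t
  proof (cases "\<exists>A. local_four_cycle F n w t A")
    case True
    then have W: "local_four_cycle F n w t (witness F n w t)" using local_four_cycle_witness by blast
    let ?S = "set (witness F n w t)"
    have S: "?S \<subseteq> transps n" "card ?S \<le> 4"
      using W cyc_local_graph_transps[of F n "last (witness F n w t) \<circ> w" "witness F n w t"]
        card_length[of "witness F n w t"] by (simp_all add: local_four_cycle_def)
    have "Q w t \<subseteq> (\<Union>x\<in>?S. {i \<in> transps n. \<not> ortho x i})"
      using ortho_sym by (auto simp: Q_def)
    then have "card (Q w t) \<le> card (\<Union>x\<in>?S. {i \<in> transps n. \<not> ortho x i})"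
      using finite_transps by (intro card_mono) auto
    also have "\<dots> \<le> (\<Sum>x\<in>?S. card {i \<in> transps n. \<not> ortho x i})" by (rule card_UN_le) simp
    also have "\<dots> \<le> (\<Sum>x\<in>?S. 2 * n)" using S by (intro sum_mono card_not_ortho) auto
    also have "\<dots> \<le> 4 * (2 * n)" using S by simp
    finally show ?thesis by simp
  next
    case False
    then have "Q w t = {}" unfolding Q_def by blast
    then show ?thesis by simp
  qed
  define h where "h = (\<lambda>(v :: nat \<Rightarrow> nat, t :: nat \<Rightarrow> nat, i :: nat \<Rightarrow> nat). (i \<circ> v, t, i))"
  have "card (SIGMA v:CT_vertices n. P v)
      \<le> card (SIGMA w:CT_vertices n. SIGMA t:nbrs F n w. Q w t)"
  proof (rule card_inj_on_le[where f = h])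
    show "inj_on h (SIGMA v:CT_vertices n. P v)"
    proof (rule inj_on_inverseI[where g = h])
      fix p assume "p \<in> (SIGMA v:CT_vertices n. P v)"
      then obtain v t i where p: "p = (v, t, i)" "(t, i) \<in> local_graph F n v" by (auto simp: P_def)
      then show "h (h p) = p"
        using transps_cancel[OF local_graphD(2)[OF p(2)]] by (simp add: h_def)
    qed
    show "h ` (SIGMA v:CT_vertices n. P v) \<subseteq> (SIGMA w:CT_vertices n. SIGMA t:nbrs F n w. Q w t)"
    proof
      fix p assume "p \<in> h ` (SIGMA v:CT_vertices n. P v)"
      then obtain v t i where p: "p = (i \<circ> v, t, i)" "v \<in> CT_vertices n" "(t, i) \<in> P v"
        by (auto simp: h_def)
      then have loc: "(t, i) \<in> local_graph F n v" by (simp add: P_def)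
      note L = local_graphD[OF loc]
      have "t \<in> nbrs F n (i \<circ> v)" using L(1,6) by (simp add: nbrs_def insert_commute comp_assoc)
      then show "p \<in> (SIGMA w:CT_vertices n. SIGMA t:nbrs F n w. Q w t)"
        using p L transps_comp_CT_vertices by (auto simp: P_def Q_def)
    qed
    show "finite (SIGMA w:CT_vertices n. SIGMA t:nbrs F n w. Q w t)"
      using finite_CT_vertices finite_nbrs finQ by blast
  qed
  also have "\<dots> = (\<Sum>w\<in>CT_vertices n. \<Sum>t\<in>nbrs F n w. card (Q w t))"
    using finite_CT_vertices finite_nbrs finQ by (subst card_SigmaI) (auto simp: card_SigmaI)
  also have "\<dots> \<le> (\<Sum>w\<in>CT_vertices n. \<Sum>t\<in>nbrs F n w. 8 * n)" by (intro sum_mono cQ)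
  also have "\<dots> = 8 * n * (\<Sum>w\<in>CT_vertices n. card (nbrs F n w))"
    by (simp add: sum_distrib_left mult.commute)
  also have "\<dots> = 16 * n * card F" using sum_degrees[OF F] by simp
  finally have "(\<Sum>v\<in>CT_vertices n. card (P v)) \<le> 16 * n * card F"
    using finite_CT_vertices finP by (simp add: card_SigmaI)
  then show ?thesis unfolding P_def .
qed

text \<open>An edge outside \<open>good_graph\<close> either lies on no local 4-cycle or, in one
  orientation, has a witness with an entry not \<open>ortho\<close> to \<open>i\<close>. Edges of
  the first kind form a relation without 4-cycles, bounded by \<open>K\<close>. The factors 2 come
  from adding the converse relation.\<close>

lemma card_local_graph_le_good:
  assumes c: "\<And>R. R \<subseteq> transps n \<times> transps n \<Longrightarrow> sym R \<Longrightarrow>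
      (\<nexists>xs. cyc R xs \<and> length xs = 4) \<Longrightarrow> real (card R) \<le> K"
  shows "real (card (local_graph F n v)) \<le> real (card (good_graph F n v)) + 2 * K
    + 2 * real (card {(t, i) \<in> local_graph F n v.
      (\<exists>A. local_four_cycle F n (i \<circ> v) t A) \<and> (\<exists>x\<in>set (witness F n (i \<circ> v) t). \<not> ortho i x)})"
proof -
  let ?L = "local_graph F n v"
  define P where "P = {(t, i) \<in> ?L.
      (\<exists>A. local_four_cycle F n (i \<circ> v) t A) \<and> (\<exists>x\<in>set (witness F n (i \<circ> v) t). \<not> ortho i x)}"
  define Z where "Z = {(t, i) \<in> ?L. \<nexists>A. cyc ?L A \<and> length A = 4 \<and> hd A = t \<and> last A = i}"
  have fin: "finite P" "finite Z" "finite (good_graph F n v)"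
    using finite_local_graph[of F n v] by (auto simp: P_def Z_def good_graph_def intro: finite_subset)
  have symZ: "sym Z"
  proof (rule symI)
    fix t i assume ti: "(t, i) \<in> Z"
    have "\<nexists>A. cyc ?L A \<and> length A = 4 \<and> hd A = i \<and> last A = t"
    proof
      assume "\<exists>A. cyc ?L A \<and> length A = 4 \<and> hd A = i \<and> last A = t"
      then obtain A where A: "cyc ?L A" "length A = 4" "hd A = i" "last A = t" by blast
      then have "A \<noteq> []" by (simp add: cyc_def)
      then have "cyc ?L (rev A) \<and> length (rev A) = 4 \<and> hd (rev A) = t \<and> last (rev A) = i"
        using cyc_rev[OF sym_local_graph A(1)] A by (simp add: hd_rev last_rev)
      then show False using ti unfolding Z_def by blast
    qed
    moreover have "(i, t) \<in> ?L" using ti symD[OF sym_local_graph] by (simp add: Z_def)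
    ultimately show "(i, t) \<in> Z" by (simp add: Z_def)
  qed
  have "real (card Z) \<le> K"
  proof (rule c[OF _ symZ])
    show "Z \<subseteq> transps n \<times> transps n" using local_graph_subset by (auto simp: Z_def)
    show "\<nexists>xs. cyc Z xs \<and> length xs = 4"
    proof
      assume "\<exists>xs. cyc Z xs \<and> length xs = 4"
      then obtain xs where xs: "cyc Z xs" "length xs = 4" by blast
      have "Z \<subseteq> ?L" by (auto simp: Z_def)
      then have "cyc ?L xs" using cyc_mono xs(1) by blast
      moreover have "(hd xs, last xs) \<in> Z" using xs(1) symD[OF symZ] by (simp add: cyc_def)
      ultimately show False using xs(2) by (auto simp: Z_def)
    qed
  qed
  have bad: "(t, i) \<in> Z \<union> P" if ti: "(t, i) \<in> ?L" "\<not> good F n (i \<circ> v) t i" for t i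
  proof (cases "(t, i) \<in> Z")
    case False
    then obtain A where A: "cyc ?L A" "length A = 4" "hd A = t" "last A = i" using ti by (auto simp: Z_def)
    have "i \<circ> (i \<circ> v) = v" using transps_cancel local_graphD(2)[OF ti(1)] by blast
    then have "local_four_cycle F n (i \<circ> v) t A" using A by (simp add: local_four_cycle_def)
    then show ?thesis using ti unfolding P_def good_def by blast
  qed simp
  have "?L \<subseteq> good_graph F n v \<union> ((Z \<union> P) \<union> (Z \<union> P)\<inverse>)"
  proof
    fix p assume "p \<in> ?L"
    moreover obtain t i where p: "p = (t, i)" by (cases p)
    ultimately have "(t, i) \<in> ?L" "(i, t) \<in> ?L" using symD[OF sym_local_graph] by auto
    then show "p \<in> good_graph F n v \<union> ((Z \<union> P) \<union> (Z \<union> P)\<inverse>)"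
      using bad[of t i] bad[of i t] p by (auto simp: good_graph_def)
  qed
  then have "card ?L \<le> card (good_graph F n v \<union> ((Z \<union> P) \<union> (Z \<union> P)\<inverse>))"
    using fin by (intro card_mono) auto
  also have "\<dots> \<le> card (good_graph F n v) + (card (Z \<union> P) + card ((Z \<union> P)\<inverse>))"
    by (meson add_left_mono card_Un_le order.trans)
  also have "\<dots> \<le> card (good_graph F n v) + 2 * (card Z + card P)"
    using card_Un_le[of Z P] by (simp add: card_inverse)
  finally have "real (card ?L) \<le> real (card (good_graph F n v) + 2 * (card Z + card P))"
    by (simp only: of_nat_le_iff)
  then show ?thesis using \<open>real (card Z) \<le> K\<close> unfolding P_def by simp
qed

lemma ex_CT_cycle_glued:
  fixes q :: nat
  assumes q: "q \<ge> 4" "even q"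
  shows "\<exists>C::real. C > 0 \<and> (\<forall>n::nat. n \<ge> 3 \<longrightarrow>
          real (ex_CT_cycle n (2 * (q + 3))) \<le> C * real n powr (- 1 / 2) * real (e_CT n))"
proof -
  obtain k where qk: "q = 2 * k" using q(2) by (elim evenE)
  have k: "k \<ge> 2" using q qk by simp
  obtain c :: real where c: "c > 0" "\<And>n R \<gamma>. n \<ge> 3 \<Longrightarrow> R \<subseteq> transps n \<times> transps n \<Longrightarrow> sym R \<Longrightarrow>
    (\<nexists>xs. cyc R xs \<and> length xs = 2 * k) \<Longrightarrow> 1 + 1 / real k \<le> \<gamma> \<Longrightarrow> real (card R) \<le> c * (real n powr \<gamma>)\<^sup>2"
    by (rule local_graph_no_cycle_card_le[OF k]) blast
  obtain c' :: real where c': "c' > 0" "\<And>n R \<gamma>. n \<ge> 3 \<Longrightarrow> R \<subseteq> transps n \<times> transps n \<Longrightarrow> sym R \<Longrightarrow>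
    (\<nexists>xs. cyc R xs \<and> length xs = 2 * 2) \<Longrightarrow> 1 + 1 / real 2 \<le> \<gamma> \<Longrightarrow> real (card R) \<le> c' * (real n powr \<gamma>)\<^sup>2"
    by (rule local_graph_no_cycle_card_le[OF order_refl]) blast
  define C where "C = 4 * c + 2 * c'"
  have "real (ex_CT_cycle n (2 * (q + 3))) \<le> 3 * (C + 18 + 1) * real n powr (- 1 / 2) * real (e_CT n)"
    if n: "n \<ge> 3" for n
  proof -
    define a where "a = (real n powr (3 / 2))\<^sup>2"
    obtain F where F: "F \<subseteq> CT_edges n" "\<not> has_cycle F (2 * (q + 3))" "card F = ex_CT_cycle n (2 * (q + 3))"
      using ex_CT_cycle_attained[of "2 * (q + 3)" n] by auto
    obtain h :: "(nat \<Rightarrow> nat) \<Rightarrow> nat" where h: "inj_on h (transps n)"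
      using finite_imp_inj_to_nat_seg[OF finite_transps] by blast
    define P where "P = (\<lambda>v. {(t, i) \<in> local_graph F n v.
      (\<exists>A. local_four_cycle F n (i \<circ> v) t A) \<and> (\<exists>x\<in>set (witness F n (i \<circ> v) t). \<not> ortho i x)})"
    have "real (card (local_graph F n v)) \<le> C * a + 2 * real (card (P v))" if v: "v \<in> CT_vertices n" for v
    proof -
      let ?G = "good_graph F n v"
      have sub: "?G \<subseteq> transps n \<times> transps n" using good_graph_subset local_graph_subset by blast
      have "\<exists>K\<subseteq>?G. sym K \<and> (\<nexists>B. cyc K B \<and> length B = q) \<and> card ?G \<le> 4 * card K"
      proof (rule forced_cycles_half[OF _ sym_good_graph sub _ h])
        show "finite ?G" using finite_subset[OF good_graph_subset finite_local_graph] .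
        show "irrefl ?G" using irrefl_local_graph[of F n v] good_graph_subset unfolding irrefl_def by blast
        show "q \<ge> 3" using q by simp
        show "last (butlast B) = (\<lambda>i t. last (butlast (witness F n (i \<circ> v) t))) (last B) (hd B)"
          if "cyc ?G B" "length B = q" for B
          using good_graph_forced[OF F(2) v that] q by simp
      qed
      then obtain K where K: "K \<subseteq> ?G" "sym K" "\<nexists>B. cyc K B \<and> length B = q" "card ?G \<le> 4 * card K" by blast
      have "real (card K) \<le> c * a"
        unfolding a_def
      proof (rule c(2)[OF n _ K(2)])
        show "K \<subseteq> transps n \<times> transps n" using K(1) sub by blast
        show "1 + 1 / real k \<le> 3 / 2" using k by (simp add: field_simps)
      qed (use K(3) qk in simp)
      moreover have "real (card (local_graph F n v)) \<le> real (card ?G) + 2 * (c' * a) + 2 * real (card (P v))"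
        unfolding P_def a_def by (intro card_local_graph_le_good c'(2)[OF n]) auto
      moreover have "real (card ?G) \<le> 4 * real (card K)" using K(4) by linarith
      ultimately show ?thesis by (simp add: C_def algebra_simps)
    qed
    then have "(\<Sum>v\<in>CT_vertices n. real (card (local_graph F n v)))
        \<le> (\<Sum>v\<in>CT_vertices n. C * a + 2 * real (card (P v)))"
      by (rule sum_mono)
    also have "\<dots> = C * fact n * a + 2 * real (\<Sum>v\<in>CT_vertices n. card (P v))"
      by (simp add: sum.distrib card_CT_vertices sum_distrib_left)
    also have "real (\<Sum>v\<in>CT_vertices n. card (P v)) \<le> real (16 * n * card F)"
      using sum_not_ortho_witness_le[OF F(1)] unfolding P_def of_nat_le_iff .
    \<comment> \<open>In units of \<open>2 * card F\<close>, the 18 consists of 2 for non-commuting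
      pairs of directions and 16 for twice the count in
      \<open>sum_not_ortho_witness_le\<close>.\<close>
    finally have "(2 * real (card F))^2 / fact n \<le> 18 * real n * (2 * real (card F)) + C * fact n * a"
      using sum_local_graph_ge_edges[OF F(1)] by (simp add: algebra_simps)
    then have "real (card F) \<le> 3 * (C + 18 + 1) * real n powr (3 / 2 - 2) * real (e_CT n)"
      unfolding a_def using c(1) c'(1) by (intro edge_bound_from_quadratic n) (auto simp: C_def)
    then show ?thesis using F(3) by simp
  qed
  moreover have "3 * (C + 18 + 1) > 0" using c(1) c'(1) by (simp add: C_def)
  ultimately show ?thesis by blast
qed

lemma ex_CT_cycle_le_e_CT: "m \<ge> 1 \<Longrightarrow> ex_CT_cycle n m \<le> e_CT n"
  using ex_CT_cycle_attained[of m n] card_mono[OF finite_CT_edges] unfolding e_CT_def by metis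

lemma ex_CT_cycle_odd:
  fixes l :: nat
  assumes "l \<ge> 4" "odd l"
  shows "\<exists>C::real. C > 0 \<and> (\<forall>n::nat. n \<ge> 3 \<longrightarrow>
          (if l = 7 then
             real (ex_CT_cycle n (2 * l)) \<le> C * real n powr (- 1 / real l) * real (e_CT n)
           else
             real (ex_CT_cycle n (2 * l)) \<le>
               C * real n powr (- 1 / 8 + 1 / (4 * (real l - 3))) * real (e_CT n)))"
proof (cases "l = 5")
  case True
  then show ?thesis
    using ex_CT_cycle_le_e_CT[of "2 * l"] by (intro exI[of _ 1]) auto
next
  case False
  define q where "q = l - 3"
  have l7: "l \<ge> 7" using assms False by presburger
  then have q: "q \<ge> 4" "even q" "l = q + 3" using assms by (auto simp: q_def)
  obtain C :: real where C: "C > 0" "\<And>n. n \<ge> 3 \<Longrightarrow>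
      real (ex_CT_cycle n (2 * l)) \<le> C * real n powr (- 1 / 2) * real (e_CT n)"
    using ex_CT_cycle_glued[OF q(1,2)] q(3) by auto
  have weaken: "real (ex_CT_cycle n (2 * l)) \<le> C * real n powr b * real (e_CT n)"
    if "n \<ge> 3" "- 1 / 2 \<le> b" for n b
  proof -
    have "C * real n powr (- 1 / 2) * real (e_CT n) \<le> C * real n powr b * real (e_CT n)"
      using that C(1) by (intro mult_right_mono mult_left_mono powr_mono) auto
    then show ?thesis using C(2)[OF that(1)] by linarith
  qed
  have "- 1 / 2 \<le> - 1 / real l" "- 1 / 2 \<le> - 1 / 8 + 1 / (4 * (real l - 3))"
    using l7 by (simp_all add: field_simps)
  then show ?thesis using C(1) weaken by (intro exI[of _ C]) auto
qed

section \<open>Six-cycles\<close>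

text \<open>The ends of an edge have disjoint neighbourhoods, so their degrees sum to at most
  \<open>card W\<close>; sum over all edges and apply Cauchy-Schwarz. As \<open>R\<close> holds both
  orientations, this is the usual bound of a quarter of \<open>(card W)\<^sup>2\<close>
  edges.\<close>

lemma mantel:
  fixes R :: "('a \<times> 'a) set"
  assumes W: "finite W" "R \<subseteq> W \<times> W" and sym: "sym R"
    and tri: "\<And>x y z. (x, y) \<in> R \<Longrightarrow> (y, z) \<in> R \<Longrightarrow> (z, x) \<in> R \<Longrightarrow> False"
  shows "2 * real (card R) \<le> (real (card W))\<^sup>2"
proof -
  define d where "d = (\<lambda>x. real (card (R `` {x})))"
  have finR: "finite R" using W finite_subset by blast
  have finI: "finite (R `` {x})" for x using finR by (rule finite_Image)
  have RS: "R = (SIGMA x:W. R `` {x})" using W by auto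
  have split: "(\<Sum>(x, y)\<in>R. f x) = (\<Sum>x\<in>W. real (card (R `` {x})) * f x)" for f :: "'a \<Rightarrow> real"
    by (subst RS, subst sum.Sigma[symmetric]) (use W(1) finI in auto)
  have cR: "real (card R) = (\<Sum>x\<in>W. d x)" using split[of "\<lambda>_. 1"] by (simp add: d_def)
  have "(\<Sum>(x, y)\<in>R. d y) = (\<Sum>(x, y)\<in>R. d x)"
    by (rule sum.reindex_bij_witness[of _ prod.swap prod.swap]) (use sym in \<open>auto elim: symE\<close>)
  then have "2 * (\<Sum>x\<in>W. (d x)\<^sup>2) = (\<Sum>(x, y)\<in>R. d x + d y)"
    using split[of d] by (simp add: d_def case_prod_unfold sum.distrib power2_eq_square)
  also have "\<dots> \<le> (\<Sum>(x, y)\<in>R. real (card W))"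
  proof (rule sum_mono, clarify)
    fix x y assume xy: "(x, y) \<in> R"
    have "R `` {x} \<inter> R `` {y} = {}" using tri[OF xy] symD[OF sym] by blast
    then have "card (R `` {x}) + card (R `` {y}) = card (R `` {x} \<union> R `` {y})"
      using finI by (simp add: card_Un_disjoint)
    also have "\<dots> \<le> card W" using W by (intro card_mono) auto
    finally show "d x + d y \<le> real (card W)" unfolding d_def of_nat_add[symmetric] of_nat_le_iff .
  qed
  also have "\<dots> = real (card W) * real (card R)" by simp
  finally have "2 * (\<Sum>x\<in>W. (d x)\<^sup>2) \<le> real (card W) * real (card R)" .
  then have "real (card W) * (2 * (\<Sum>x\<in>W. (d x)\<^sup>2)) \<le> real (card W) * (real (card W) * real (card R))"
    by (intro mult_left_mono) auto
  then have "2 * (real (card R))\<^sup>2 \<le> (real (card W))\<^sup>2 * real (card R)"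
    using sum_squared_le_card_mult[OF W(1), of d] cR by (simp add: power2_eq_square algebra_simps)
  then show ?thesis by (cases "card R = 0") (auto simp: power2_eq_square)
qed

text \<open>The lift of the path has five vertices, and the base \<open>v\<close>, adjacent in
  \<open>F\<close> to both of its ends, closes it.\<close>

lemma local_path_imp_six_cycle:
  assumes ik: "(i, k) \<in> local_graph F n v" and km: "(k, m) \<in> local_graph F n v"
    and "i \<in> nbrs F n v" "m \<in> nbrs F n v" "i \<noteq> m" and v: "surj v"
  shows "has_cycle F 6"
proof -
  note T = local_graphD[OF ik] local_graphD[OF km]
  have d: "distinct [i, k, m]" using T assms(5) by (auto simp: ortho_def)
  have s: "successively (\<lambda>x y. (x, y) \<in> local_graph F n v) [i, k, m]" using ik km by simp
  have "distinct (zigzag v [i, k, m])"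
    using T by (intro distinct_zigzag[OF s _ d v]) auto
  moreover have ne1: "v \<noteq> x \<circ> v" if "x \<in> transps n" for x
    using comp_right_cancel[OF v, of id x] transps_moves[OF that] by auto
  moreover have ne2: "v \<noteq> x \<circ> y \<circ> v" if "x \<in> transps n" "y \<in> transps n" "ortho x y" for x y
  proof
    assume "v = x \<circ> y \<circ> v"
    then have "x \<circ> y = id" using comp_right_cancel[OF v, of id "x \<circ> y"] by simp
    then have "x \<circ> (x \<circ> y) = x" by simp
    then show False using transps_cancel[OF that(1)] that(3) by (metis ortho_def)
  qed
  have "v \<notin> set (zigzag v [i, k, m])"
    using ne1[OF T(1)] ne1[OF T(2)] ne1[OF T(8)] ne2[OF T(1-3)] ne2[OF T(7-9)] by simp
  ultimately have "distinct (v # zigzag v [i, k, m])" by (simp only: distinct.simps simp_thms)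
  moreover have "successively (\<lambda>p q. {p, q} \<in> F) (v # zigzag v [i, k, m])"
    using successively_zigzag[OF s] assms(3) by (simp add: nbrs_def)
  moreover have "{last (v # zigzag v [i, k, m]), hd (v # zigzag v [i, k, m])} \<in> F"
    using assms(4) by (simp add: nbrs_def insert_commute)
  ultimately have "has_cycle F (length (v # zigzag v [i, k, m]))" by (intro has_cycleI) auto
  then show ?thesis by (simp add: numeral_eq_Suc)
qed

text \<open>Pairs that meet the directions of \<open>F\<close> number at most one per transposition
  and orientation. They are linear in \<open>n choose 2\<close>, whereas Mantel's bound on the rest
  is quadratic.\<close>

lemma card_local_graph_no_six_cycle:
  assumes F: "\<not> has_cycle F 6" and v: "v \<in> CT_vertices n"
  shows "real (card (local_graph F n v))
    \<le> (real (n choose 2) - real (card (nbrs F n v)))\<^sup>2 / 2 + 2 * real (n choose 2)"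
proof -
  let ?L = "local_graph F n v"
  define A where "A = nbrs F n v"
  define W where "W = transps n - A"
  define S where "S = {(k, i) \<in> ?L. i \<in> A}"
  have A: "A \<subseteq> transps n" "finite A" using finite_nbrs by (auto simp: A_def nbrs_def)
  have sv: "surj v" using v surj_CT_vertices by blast
  have finS: "finite S" using finite_local_graph[of F n v] by (auto simp: S_def intro: finite_subset)
  have "card (?L \<inter> W \<times> W) * 2 \<le> (card W)\<^sup>2"
  proof -
    have "2 * real (card (?L \<inter> W \<times> W)) \<le> (real (card W))\<^sup>2"
    proof (rule mantel)
      show "finite W" using finite_transps by (simp add: W_def)
      show "sym (?L \<inter> W \<times> W)" using sym_local_graph[of F n v] by (auto simp: sym_def)
      fix x y z assume "(x, y) \<in> ?L \<inter> W \<times> W" "(y, z) \<in> ?L \<inter> W \<times> W" "(z, x) \<in> ?L \<inter> W \<times> W"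
      then have xyz: "(x, y) \<in> ?L" "(y, z) \<in> ?L" "(z, x) \<in> ?L" by auto
      then have "cyc ?L [x, y, z]"
        using local_graphD(3)[OF xyz(1)] local_graphD(3)[OF xyz(2)] local_graphD(3)[OF xyz(3)]
        by (auto simp: cyc_def ortho_def)
      then show False using local_cycle_imp_cycle[of F n v "[x, y, z]"] sv F by simp
    qed simp
    then show ?thesis by (metis mult.commute of_nat_le_iff of_nat_mult of_nat_numeral of_nat_power)
  qed
  then have 1: "real (card (?L \<inter> W \<times> W)) \<le> (real (card W))\<^sup>2 / 2"
    by (simp flip: of_nat_power)
  have "inj_on fst S"
  proof (rule inj_onI)
    fix p p' assume p: "p \<in> S" "p' \<in> S" "fst p = fst p'"
    obtain k i i' where pp: "p = (k, i)" "p' = (k, i')" using p(3) by (metis prod.collapse)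
    have "(i, k) \<in> ?L" "(k, i') \<in> ?L" "i \<in> nbrs F n v" "i' \<in> nbrs F n v"
      using p pp symD[OF sym_local_graph] by (auto simp: S_def A_def)
    then have "i = i'" using local_path_imp_six_cycle[OF _ _ _ _ _ sv] F by blast
    then show "p = p'" using pp by simp
  qed
  moreover have "fst ` S \<subseteq> transps n" by (auto simp: S_def dest: local_graphD(1))
  ultimately have 2: "card S \<le> n choose 2"
    using card_inj_on_le finite_transps card_transps by metis
  have "?L \<subseteq> (?L \<inter> W \<times> W) \<union> (S \<union> S\<inverse>)"
  proof
    fix p assume "p \<in> ?L"
    moreover obtain x y where p: "p = (x, y)" by (cases p)
    ultimately have "(x, y) \<in> ?L" "(y, x) \<in> ?L" "x \<in> transps n" "y \<in> transps n"
      using symD[OF sym_local_graph] local_graphD(1,2) by blast+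
    then show "p \<in> (?L \<inter> W \<times> W) \<union> (S \<union> S\<inverse>)" using p by (auto simp: S_def W_def)
  qed
  then have "card ?L \<le> card ((?L \<inter> W \<times> W) \<union> (S \<union> S\<inverse>))"
    using finS finite_local_graph by (intro card_mono) auto
  also have "\<dots> \<le> card (?L \<inter> W \<times> W) + (card S + card (S\<inverse>))"
    by (meson add_left_mono card_Un_le order.trans)
  also have "\<dots> \<le> card (?L \<inter> W \<times> W) + 2 * (n choose 2)" using 2 by (simp add: card_inverse)
  finally have "real (card ?L) \<le> real (card (?L \<inter> W \<times> W) + 2 * (n choose 2))"
    by (simp only: of_nat_le_iff)
  moreover have "real (card W) = real (n choose 2) - real (card A)"
    using A card_mono[OF finite_transps A(1)] by (simp add: W_def card_Diff_subset card_transps of_nat_diff)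
  ultimately show ?thesis using 1 by (simp add: A_def)
qed

text \<open>Mantel's bound \<open>(N - d)\<^sup>2 / 2\<close> absorbs only half of the
  \<open>d\<^sup>2\<close>. The remaining half has a positive coefficient, so Cauchy-Schwarz can
  replace the degrees by their average. Up to lower order terms this gives
  \<open>\<alpha>\<^sup>2 + 2 * \<alpha> \<le> 1\<close>.\<close>

lemma six_cycle_density:
  assumes n: "n \<ge> 3" and F: "F \<subseteq> CT_edges n" "\<not> has_cycle F 6"
  shows "(real (card F) / real (e_CT n) + 1)\<^sup>2 \<le> 2 + 16 / real n"
proof -
  define N where "N = real (n choose 2)"
  define m where "m = (fact n :: real)"
  define S where "S = 2 * real (card F)"
  define \<alpha> where "\<alpha> = S / (m * N)"
  let ?d = "\<lambda>v. real (card (nbrs F n v))"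
  have N: "N = real n * (real n - 1) / 2" "N > 0"
    using n by (simp_all add: N_def choose_two real_of_nat_div of_nat_diff)
  have m: "m > 0" "real (card (CT_vertices n)) = m" by (simp_all add: m_def card_CT_vertices)
  have e: "2 * real (e_CT n) = m * N"
    using arg_cong[OF e_CT_eq[of n], of real] by (simp add: m_def N_def)
  have e_pos: "real (e_CT n) > 0" using e N(2) m(1) mult_pos_pos[of m N] by linarith
  have "\<alpha> = (2 * real (card F)) / (2 * real (e_CT n))" by (simp add: \<alpha>_def S_def e)
  then have "real (card F) / real (e_CT n) = \<alpha>" by simp
  moreover have "S = \<alpha> * (m * N)" using N(2) m(1) by (simp add: \<alpha>_def)
  ultimately have \<alpha>: "real (card F) / real (e_CT n) = \<alpha>" "S = \<alpha> * (m * N)" by blast+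
  have "real (card F) \<le> real (e_CT n)"
    using card_mono[OF finite_CT_edges F(1)] by (simp add: e_CT_def)
  then have \<alpha>1: "0 \<le> \<alpha>" "\<alpha> \<le> 1" unfolding \<alpha>(1)[symmetric] using e_pos by simp_all
  have sumd: "(\<Sum>v\<in>CT_vertices n. ?d v) = S"
    using sum_degrees[OF F(1)] unfolding S_def by (metis of_nat_mult of_nat_numeral of_nat_sum)
  have sq: "S\<^sup>2 \<le> m * (\<Sum>v\<in>CT_vertices n. (?d v)\<^sup>2)"
    using sum_squared_le_card_mult[OF finite_CT_vertices, of ?d n] sumd m by simp
  have "(\<Sum>v\<in>CT_vertices n. (?d v)\<^sup>2 - 2 * real n * ?d v)
      \<le> (\<Sum>v\<in>CT_vertices n. (N - ?d v)\<^sup>2 / 2 + 2 * N)"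
  proof -
    have "real (\<Sum>v\<in>CT_vertices n. card (local_graph F n v)) \<le> (\<Sum>v\<in>CT_vertices n. (N - ?d v)\<^sup>2 / 2 + 2 * N)"
      unfolding of_nat_sum N_def by (intro sum_mono card_local_graph_no_six_cycle F(2))
    then show ?thesis using sum_local_graph_ge_degrees[of F n] by linarith
  qed
  also have "\<dots> = (\<Sum>v\<in>CT_vertices n. (?d v)\<^sup>2 / 2 - N * ?d v + (N\<^sup>2 / 2 + 2 * N))"
    by (intro sum.cong) (auto simp: power2_eq_square field_simps)
  also have "\<dots> = (\<Sum>v\<in>CT_vertices n. (?d v)\<^sup>2) / 2 - N * S + m * (N\<^sup>2 / 2 + 2 * N)"
    by (simp add: sum.distrib sum_subtractf sumd m(2) flip: sum_distrib_left sum_divide_distrib)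
  also have "(\<Sum>v\<in>CT_vertices n. (?d v)\<^sup>2 - 2 * real n * ?d v)
      = (\<Sum>v\<in>CT_vertices n. (?d v)\<^sup>2) - 2 * real n * S"
    by (simp add: sum_subtractf sumd flip: sum_distrib_left)
  finally have "(\<Sum>v\<in>CT_vertices n. (?d v)\<^sup>2) / 2 \<le> 2 * real n * S - N * S + m * (N\<^sup>2 / 2 + 2 * N)"
    by simp
  then have "m * (\<Sum>v\<in>CT_vertices n. (?d v)\<^sup>2) \<le> m * (2 * (2 * real n * S - N * S + m * (N\<^sup>2 / 2 + 2 * N)))"
    using m(1) by (intro mult_left_mono) auto
  then have "S\<^sup>2 \<le> m * (2 * (2 * real n * S - N * S + m * (N\<^sup>2 / 2 + 2 * N)))" using sq by linarith
  then have "(m * m * N) * (N * \<alpha>\<^sup>2) \<le> (m * m * N) * (4 * real n * \<alpha> - 2 * N * \<alpha> + N + 4)"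
    unfolding \<alpha>(2) by (simp add: power2_eq_square algebra_simps)
  then have "N * \<alpha>\<^sup>2 \<le> 4 * real n * \<alpha> - 2 * N * \<alpha> + N + 4"
    using m N(2) by (simp add: mult_le_cancel_left_pos)
  then have "N * (\<alpha> + 1)\<^sup>2 \<le> 2 * N + 4 * real n * \<alpha> + 4"
    by (simp add: power2_eq_square algebra_simps)
  also have "\<dots> \<le> 2 * N + 4 * real n * 1 + 4"
    using \<alpha>1 by (intro add_mono mult_left_mono) auto
  \<comment> \<open>\<open>16 * N / n\<close> is \<open>8 * (n - 1)\<close>, which is at least
    \<open>4 * n + 4\<close> from \<open>n = 3\<close> on.\<close>
  also have "\<dots> \<le> N * (2 + 16 / real n)"
    using n by (simp add: N field_simps)
  finally show ?thesis using N(2) unfolding \<alpha>(1) by simp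
qed

lemma ex_CT_six_cycle:
  fixes \<epsilon> :: real
  assumes "\<epsilon> > 0"
  shows "\<exists>N::nat. \<forall>n::nat. n \<ge> max N 3 \<longrightarrow>
          real (ex_CT_cycle n 6) \<le> (sqrt 2 - 1 + \<epsilon>) * real (e_CT n)"
proof (intro exI allI impI)
  \<comment> \<open>The threshold gives \<open>16 / n \<le> 2 * \<epsilon>\<close>, and
    \<open>2 + 2 * \<epsilon>\<close> is less than the square of
    \<open>sqrt 2 + \<epsilon>\<close>.\<close>
  fix n :: nat assume n: "n \<ge> max (nat \<lceil>8 / \<epsilon>\<rceil>) 3"
  obtain F where F: "F \<subseteq> CT_edges n" "\<not> has_cycle F 6" "card F = ex_CT_cycle n 6"
    using ex_CT_cycle_attained[of 6 n] by auto
  define \<alpha> where "\<alpha> = real (card F) / real (e_CT n)"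
  have n3: "n \<ge> 3" using n by simp
  have "8 / \<epsilon> \<le> real n" using n by linarith
  then have "16 / real n \<le> 2 * \<epsilon>" using n3 assms by (simp add: field_simps)
  then have sq: "(\<alpha> + 1)\<^sup>2 \<le> 2 + 2 * \<epsilon>" using six_cycle_density[OF n3 F(1,2)] by (simp add: \<alpha>_def)
  have "\<alpha> \<le> sqrt 2 - 1 + \<epsilon>"
  proof (rule ccontr)
    assume "\<not> ?thesis"
    then have "sqrt 2 + \<epsilon> < \<alpha> + 1" by simp
    then have "(sqrt 2 + \<epsilon>)\<^sup>2 < (\<alpha> + 1)\<^sup>2" using assms by (intro power_strict_mono) auto
    moreover have "(sqrt 2 + \<epsilon>)\<^sup>2 = 2 + 2 * sqrt 2 * \<epsilon> + \<epsilon>\<^sup>2" by (simp add: power2_sum)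
    moreover have "1 * \<epsilon> \<le> sqrt 2 * \<epsilon>" using assms by (intro mult_right_mono) auto
    moreover have "\<epsilon>\<^sup>2 > 0" using assms by simp
    ultimately show False using sq by linarith
  qed
  moreover have "2 * e_CT n > 0" unfolding e_CT_eq using n3 by simp
  then have "real (card F) = \<alpha> * real (e_CT n)" by (simp add: \<alpha>_def)
  ultimately show "real (ex_CT_cycle n 6) \<le> (sqrt 2 - 1 + \<epsilon>) * real (e_CT n)"
    unfolding F(3)[symmetric] by (simp add: mult_right_mono)
qed

section \<open>Four-cycles\<close>

definition distinct_pairs :: "nat \<Rightarrow> (nat \<times> nat) set" where
  "distinct_pairs n = {(a, b). a \<in> {1..n} \<and> b \<in> {1..n} \<and> a \<noteq> b}"

text \<open>Ordered, so that permuting coordinates is a bijection and the three transpositions of a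
  triple have equal sums.\<close>

definition distinct_triples :: "nat \<Rightarrow> (nat \<times> nat \<times> nat) set" where
  "distinct_triples n = {(a, b, c). a \<in> {1..n} \<and> b \<in> {1..n} \<and> c \<in> {1..n} \<and> a \<noteq> b \<and> b \<noteq> c \<and> a \<noteq> c}"

lemma finite_distinct_pairs: "finite (distinct_pairs n)"
  by (rule finite_subset[of _ "{1..n} \<times> {1..n}"]) (auto simp: distinct_pairs_def)

lemma sum_distinct_triples:
  fixes f :: "nat \<Rightarrow> nat \<Rightarrow> real"
  assumes "n \<ge> 2"
  shows "(\<Sum>(a, b, c)\<in>distinct_triples n. f a b) = (real n - 2) * (\<Sum>(a, b)\<in>distinct_pairs n. f a b)"
proof -
  let ?S = "SIGMA p:distinct_pairs n. {1..n} - {fst p, snd p}"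
  have "(\<Sum>(a, b, c)\<in>distinct_triples n. f a b) = (\<Sum>(p, c)\<in>?S. f (fst p) (snd p))"
    by (rule sum.reindex_bij_witness[of _ "\<lambda>((a, b), c). (a, b, c)" "\<lambda>(a, b, c). ((a, b), c)"])
       (auto simp: distinct_triples_def distinct_pairs_def)
  also have "\<dots> = (\<Sum>p\<in>distinct_pairs n. \<Sum>c\<in>{1..n} - {fst p, snd p}. f (fst p) (snd p))"
    using finite_distinct_pairs by (subst sum.Sigma) auto
  also have "\<dots> = (\<Sum>p\<in>distinct_pairs n. (real n - 2) * f (fst p) (snd p))"
  proof (rule sum.cong)
    fix p assume "p \<in> distinct_pairs n"
    then have "card ({1..n} - {fst p, snd p}) = n - 2" by (auto simp: distinct_pairs_def card_Diff_subset)
    then show "(\<Sum>c\<in>{1..n} - {fst p, snd p}. f (fst p) (snd p)) = (real n - 2) * f (fst p) (snd p)"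
      using assms by simp
  qed simp
  finally show ?thesis by (simp add: sum_distrib_left case_prod_unfold)
qed

lemma sum_distinct_pairs:
  fixes g :: "(nat \<Rightarrow> nat) \<Rightarrow> real"
  shows "(\<Sum>(a, b)\<in>distinct_pairs n. g (Transposition.transpose a b)) = 2 * (\<Sum>t\<in>transps n. g t)"
proof -
  define \<tau> where "\<tau> = (\<lambda>(a :: nat, b). Transposition.transpose a b)"
  have "(\<Sum>(a, b)\<in>distinct_pairs n. g (Transposition.transpose a b)) = (\<Sum>p\<in>distinct_pairs n. g (\<tau> p))"
    by (simp add: \<tau>_def case_prod_unfold)
  also have "\<dots> = (\<Sum>t\<in>transps n. \<Sum>p\<in>{p \<in> distinct_pairs n. \<tau> p = t}. g (\<tau> p))"
    by (rule sum.group[symmetric, OF finite_distinct_pairs finite_transps])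
       (auto simp: distinct_pairs_def transps_def \<tau>_def)
  also have "\<dots> = (\<Sum>t\<in>transps n. 2 * g t)"
  proof (rule sum.cong)
    fix t assume "t \<in> transps n"
    then obtain a b where ab: "t = Transposition.transpose a b" "a \<in> {1..n}" "b \<in> {1..n}" "a \<noteq> b"
      by (auto simp: transps_def)
    have fib: "{p \<in> distinct_pairs n. \<tau> p = t} = {(a, b), (b, a)}"
    proof (intro equalityI subsetI)
      fix p assume p: "p \<in> {p \<in> distinct_pairs n. \<tau> p = t}"
      obtain c d where cd: "p = (c, d)" by (cases p)
      then have "c \<noteq> d" "Transposition.transpose c d = Transposition.transpose a b"
        using p ab by (auto simp: distinct_pairs_def \<tau>_def)
      then have "{x. Transposition.transpose c d x \<noteq> x} = {x. Transposition.transpose a b x \<noteq> x}" by simp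
      moreover have "{x. Transposition.transpose c d x \<noteq> x} = {c, d}" if "c \<noteq> d" for c d :: nat
        using that by (auto simp: transpose_def)
      ultimately have "{c, d} = {a, b}" using \<open>c \<noteq> d\<close> ab(4) by metis
      then show "p \<in> {(a, b), (b, a)}" using cd by (auto simp: doubleton_eq_iff)
    qed (use ab in \<open>auto simp: distinct_pairs_def \<tau>_def transpose_commute\<close>)
    have "(\<Sum>p\<in>{p \<in> distinct_pairs n. \<tau> p = t}. g (\<tau> p)) = (\<Sum>p\<in>{p \<in> distinct_pairs n. \<tau> p = t}. g t)"
      by (intro sum.cong) auto
    then show "(\<Sum>p\<in>{p \<in> distinct_pairs n. \<tau> p = t}. g (\<tau> p)) = 2 * g t"
      unfolding fib using ab(4) by simp
  qed simp
  finally show ?thesis by (simp add: sum_distrib_left)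
qed

text \<open>From (b c)(a b) = (a b)(a c): the cycle is \<open>v\<close>, \<open>t \<circ> v\<close>,
  \<open>s \<circ> t \<circ> v\<close>, \<open>u \<circ> v\<close>, with direction \<open>t\<close>
  on two opposite edges.\<close>

lemma four_cycle_triple:
  assumes abc: "(a, b, c) \<in> distinct_triples n" and v: "surj v"
    and t: "t = Transposition.transpose a b" and s: "s = Transposition.transpose b c"
    and u: "u = Transposition.transpose a c"
    and E: "{v, t \<circ> v} \<in> F" "{t \<circ> v, s \<circ> (t \<circ> v)} \<in> F" "{u \<circ> v, t \<circ> (u \<circ> v)} \<in> F" "{v, u \<circ> v} \<in> F"
  shows "has_cycle F 4"
proof -
  have d: "a \<noteq> b" "b \<noteq> c" "a \<noteq> c" using abc by (auto simp: distinct_triples_def)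
  have stu: "s \<circ> t = t \<circ> u" using d unfolding s t u by (auto simp: fun_eq_iff transpose_def)
  then have st: "t \<circ> (u \<circ> v) = s \<circ> (t \<circ> v)" by (metis comp_assoc)
  have "t a = b" "u a = c" "(s \<circ> t) a = c" "(s \<circ> t) b = a" "t b = a" "u b = b" using d by (auto simp: s t u)
  then have "id \<noteq> t" "id \<noteq> s \<circ> t" "id \<noteq> u" "t \<noteq> s \<circ> t" "t \<noteq> u" "s \<circ> t \<noteq> u"
    using d by (metis id_apply)+
  then have "id \<circ> v \<noteq> t \<circ> v" "id \<circ> v \<noteq> s \<circ> t \<circ> v" "id \<circ> v \<noteq> u \<circ> v"
      "t \<circ> v \<noteq> s \<circ> t \<circ> v" "t \<circ> v \<noteq> u \<circ> v" "s \<circ> t \<circ> v \<noteq> u \<circ> v"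
    unfolding comp_right_cancel[OF v] .
  then have "distinct [v, t \<circ> v, s \<circ> (t \<circ> v), u \<circ> v]" by (simp add: comp_assoc)
  then have "has_cycle F (length [v, t \<circ> v, s \<circ> (t \<circ> v), u \<circ> v])"
    using E by (intro has_cycleI) (auto simp: comp_assoc st insert_commute)
  then show ?thesis by (simp add: numeral_eq_Suc)
qed

lemma sum_CT_vertices_transp:
  assumes "t \<in> transps n"
  shows "(\<Sum>v\<in>CT_vertices n. f (t \<circ> v)) = (\<Sum>v\<in>CT_vertices n. f v)"
  by (rule sum.reindex_bij_witness[of _ "\<lambda>v. t \<circ> v" "\<lambda>v. t \<circ> v"])
     (use assms transps_cancel transps_comp_CT_vertices in auto)

lemma ex_CT_four_cycle:
  assumes n: "n \<ge> 3"
  shows "real (ex_CT_cycle n 4) \<le> 3 / 4 * real (e_CT n)"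
proof -
  obtain F where F: "F \<subseteq> CT_edges n" "\<not> has_cycle F 4" "card F = ex_CT_cycle n 4"
    using ex_CT_cycle_attained[of 4 n] by auto
  \<comment> \<open>\<open>\<chi>\<close> marks missing edges, and \<open>g t\<close> counts the
    vertices whose edge in direction \<open>t\<close> is missing.\<close>
  define \<chi> where "\<chi> = (\<lambda>v t. if {v, t \<circ> v} \<in> F then 0 else 1 :: real)"
  define g where "g = (\<lambda>t. \<Sum>v\<in>CT_vertices n. \<chi> v t)"
  define m where "m = (fact n :: real)"
  define \<tau> where "\<tau> = (Transposition.transpose :: nat \<Rightarrow> nat \<Rightarrow> _)"
  \<comment> \<open>Each of the \<open>m\<close> starting points yields a 4-cycle with a missing
    edge. Translation by a transposition permutes the vertices, so every position on the cycle
    contributes a full sum \<open>g\<close>, and the repeated direction contributes twice.\<close>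
  have triple: "m \<le> 2 * g (\<tau> a b) + g (\<tau> b c) + g (\<tau> a c)"
    if abc: "(a, b, c) \<in> distinct_triples n" for a b c
  proof -
    have T: "\<tau> a b \<in> transps n" "\<tau> a c \<in> transps n"
      using abc by (auto simp: distinct_triples_def transps_def \<tau>_def)
    have "m = (\<Sum>v\<in>CT_vertices n. 1)" by (simp add: m_def card_CT_vertices)
    also have "\<dots> \<le> (\<Sum>v\<in>CT_vertices n. \<chi> v (\<tau> a b) + \<chi> (\<tau> a b \<circ> v) (\<tau> b c)
        + \<chi> (\<tau> a c \<circ> v) (\<tau> a b) + \<chi> v (\<tau> a c))"
    proof (rule sum_mono)
      fix v assume "v \<in> CT_vertices n"
      then have "surj v" by (rule surj_CT_vertices)
      then have "\<not> ({v, \<tau> a b \<circ> v} \<in> F \<and> {\<tau> a b \<circ> v, \<tau> b c \<circ> (\<tau> a b \<circ> v)} \<in> F \<and>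
          {\<tau> a c \<circ> v, \<tau> a b \<circ> (\<tau> a c \<circ> v)} \<in> F \<and> {v, \<tau> a c \<circ> v} \<in> F)"
        using four_cycle_triple[OF abc _ refl refl refl] F(2) unfolding \<tau>_def by blast
      then show "1 \<le> \<chi> v (\<tau> a b) + \<chi> (\<tau> a b \<circ> v) (\<tau> b c) + \<chi> (\<tau> a c \<circ> v) (\<tau> a b) + \<chi> v (\<tau> a c)"
        unfolding \<chi>_def by (simp split: if_splits)
    qed
    also have "\<dots> = 2 * g (\<tau> a b) + g (\<tau> b c) + g (\<tau> a c)"
      using sum_CT_vertices_transp[OF T(1), of "\<lambda>v. \<chi> v (\<tau> b c)"]
        sum_CT_vertices_transp[OF T(2), of "\<lambda>v. \<chi> v (\<tau> a b)"]
      by (simp add: sum.distrib g_def)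
    finally show ?thesis .
  qed
  have comm: "\<tau> a b = \<tau> b a" for a b by (simp add: \<tau>_def transpose_commute)
  define G where "G = (\<Sum>(a, b, c)\<in>distinct_triples n. g (\<tau> a b))"
  have G2: "(\<Sum>(a, b, c)\<in>distinct_triples n. g (\<tau> b c)) = G"
    unfolding G_def
    by (rule sum.reindex_bij_witness[of _ "\<lambda>(a, b, c). (c, a, b)" "\<lambda>(a, b, c). (b, c, a)"])
       (auto simp: distinct_triples_def)
  have G3: "(\<Sum>(a, b, c)\<in>distinct_triples n. g (\<tau> a c)) = G"
    unfolding G_def
    by (rule sum.reindex_bij_witness[of _ "\<lambda>(a, b, c). (a, c, b)" "\<lambda>(a, b, c). (a, c, b)"])
       (auto simp: distinct_triples_def)
  have "(\<Sum>(a, b, c)\<in>distinct_triples n. m)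
      \<le> (\<Sum>(a, b, c)\<in>distinct_triples n. 2 * g (\<tau> a b) + g (\<tau> b c) + g (\<tau> a c))"
    by (rule sum_mono) (use triple in auto)
  \<comment> \<open>The weights 2 + 1 + 1 merge by symmetry: on average at least a quarter of the
    edges is missing.\<close>
  also have "\<dots> = 4 * G"
    using G2 G3 by (simp add: G_def case_prod_unfold sum.distrib flip: sum_distrib_left)
  finally have "(\<Sum>(a, b, c)\<in>distinct_triples n. m) \<le> 4 * G" .
  moreover have "(\<Sum>(a, b, c)\<in>distinct_triples n. m) = (real n - 2) * (2 * (\<Sum>t\<in>transps n. m))"
    using sum_distinct_triples[of n "\<lambda>a b. m"] n by (simp only: sum_distinct_pairs[of "\<lambda>t. m" n])
  moreover have "G = (real n - 2) * (2 * (\<Sum>t\<in>transps n. g t))"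
    using sum_distinct_triples[of n "\<lambda>a b. g (\<tau> a b)"] sum_distinct_pairs[of g n] n
    by (simp add: G_def \<tau>_def)
  ultimately have "(real n - 2) * (2 * (\<Sum>t\<in>transps n. m)) \<le> (real n - 2) * (2 * (4 * (\<Sum>t\<in>transps n. g t)))"
    by (simp add: algebra_simps)
  then have main: "(\<Sum>t\<in>transps n. m) \<le> 4 * (\<Sum>t\<in>transps n. g t)"
    using n by (simp add: mult.commute)
  have "(\<Sum>t\<in>transps n. g t) = (\<Sum>v\<in>CT_vertices n. \<Sum>t\<in>transps n. \<chi> v t)"
    unfolding g_def by (rule sum.swap)
  also have "\<dots> = (\<Sum>v\<in>CT_vertices n. real (n choose 2) - real (card (nbrs F n v)))"
  proof (rule sum.cong)
    fix v
    have "(\<Sum>t\<in>transps n. \<chi> v t) = (\<Sum>t\<in>transps n. 1 - (if {v, t \<circ> v} \<in> F then 1 else 0))"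
      by (intro sum.cong) (auto simp: \<chi>_def)
    also have "\<dots> = real (n choose 2) - real (card {t \<in> transps n. {v, t \<circ> v} \<in> F})"
      using finite_transps by (simp add: sum_subtractf card_transps Collect_conj_eq flip: sum.inter_filter)
    finally show "(\<Sum>t\<in>transps n. \<chi> v t) = real (n choose 2) - real (card (nbrs F n v))"
      by (simp add: nbrs_def)
  qed simp
  also have "\<dots> = m * real (n choose 2) - 2 * real (card F)"
    using arg_cong[OF sum_degrees[OF F(1)], of real] by (simp add: sum_subtractf m_def card_CT_vertices)
  finally have "m * real (n choose 2) \<le> 4 * (m * real (n choose 2) - 2 * real (card F))"
    using main by (simp add: card_transps mult.commute)
  moreover have "2 * real (e_CT n) = m * real (n choose 2)"
    using arg_cong[OF e_CT_eq[of n], of real] by (simp add: m_def)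
  ultimately have "2 * real (e_CT n) \<le> 4 * (2 * real (e_CT n) - 2 * real (card F))" by simp
  then show ?thesis using F(3) by simp
qed

theorem theorem1p1:
  shows
   "(\<forall>l::nat. l \<ge> 4 \<and> even l \<longrightarrow>
       (\<exists>C::real. C > 0 \<and> (\<forall>n::nat. n \<ge> 3 \<longrightarrow>
          real (ex_CT_cycle n (2 * l)) \<le> C * real n powr (-1 + 2 / real l) * real (e_CT n))))
  \<and> (\<forall>l::nat. l \<ge> 4 \<and> odd l \<longrightarrow>
       (\<exists>C::real. C > 0 \<and> (\<forall>n::nat. n \<ge> 3 \<longrightarrow>
          (if l = 7 then
             real (ex_CT_cycle n (2 * l)) \<le> C * real n powr (- 1 / real l) * real (e_CT n)
           else
             real (ex_CT_cycle n (2 * l)) \<le>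
               C * real n powr (- 1 / 8 + 1 / (4 * (real l - 3))) * real (e_CT n)))))
  \<and> (\<forall>\<epsilon>::real. \<epsilon> > 0 \<longrightarrow> (\<exists>N::nat. \<forall>n::nat. n \<ge> max N 3 \<longrightarrow>
          real (ex_CT_cycle n 6) \<le> (sqrt 2 - 1 + \<epsilon>) * real (e_CT n)))
  \<and> (\<forall>n::nat. n \<ge> 3 \<longrightarrow> real (ex_CT_cycle n 4) \<le> 3 / 4 * real (e_CT n))"
  using ex_CT_cycle_even ex_CT_cycle_odd ex_CT_six_cycle ex_CT_four_cycle by blast

end
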